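(* Let $(G_n)_{n\ge1}$, $G_n=(V(G_n),E(G_n))$ with $|V(G_n)|=n$, be a locally tree-like sequence of random graphs with local limit $(G,o)$, and let $D_o$ be the degree of the root $o$ in $G$. Let $q\ge2$, $w\ge0$, $B\ge0$, and put $$k=\frac14\log\Big(\frac{1+w}{1+w/(q-1)}\Big),\qquad \beta^*=\frac14\log\big((1+w)(1+w/(q-1))\big),\qquad h=\frac12\log\Big(\frac{e^B}{q-1}\Big).$$ Then $$\lim_{n\to\infty}\frac1n\log Z_{G_n}(q,w,B)=\frac{\beta^*}{2}\mathbb E[D_o]+\frac12\log\big(e^{-B}(q-1)\big)+\lim_{n\to\infty}\frac1n\log Z^{\mathrm{eIsing}}_{G_n}(\beta^*,k,h),$$ provided the limit on the right-hand side exists (limits being in probability).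
   Context: For a finite graph $G$ and $\omega\in\{0,1\}^{E(G)}$, $\mathscr C(\omega)$ is the collection of connected components of $(V(G),\{e:\omega_e=1\})$ (isolated vertices are components), $|C|$ is the number of vertices of $C$, and $$Z_G(q,w,B)=\sum_{\omega\in\{0,1\}^{E(G)}}\prod_{e\in E(G)}w^{\omega_e}\prod_{C\in\mathscr C(\omega)}\big(1+(q-1)e^{-B|C|}\big).$$ The extended Ising partition function is $$Z^{\mathrm{eIsing}}_G(\beta,k,h)=\sum_{\sigma\in\{-1,1\}^{V(G)}}\exp\Big(\beta\sum_{\{u,v\}\in E(G)}\sigma_u\sigma_v+\sum_{v\in V(G)}(k d_v+h)\sigma_v\Big),$$ where $d_v$ is the degree of $v$ in $G$. The sequence $(G_n)$ is called locally tree-like when both of the following hold. (i) Uniform sparsity: the degree $D_n$ of a uniformly random vertex of $G_n$ satisfies $D_n\to D$ in distribution and $\mathbb E[D_n]\to\mathbb E[D]<\infty$ for some random variable $D$. (ii) $G_n$ converges locally in probability to a random rooted graph $(G,o)$ that is almost surely a tree, i.e., for every $r\ge 0$ and every finite rooted graph $H$, the proportion of vertices $v\in V(G_n)$ whose rooted $r$-neighbourhood in $G_n$ is isomorphic to $H$ converges in probability to the probability that the $r$-neighbourhood of $o$ in $G$ is isomorphic to $H$. *)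

theory Defs
  imports "HOL-Probability.Probability"
begin

text \<open>Simple graphs, possibly infinite: an edge is a two-element set of vertices.\<close>

datatype 'v ugraph = UGraph (verts: "'v set") (edges: "'v set set")

definition simple_graph :: "'v ugraph \<Rightarrow> bool" where
  "simple_graph g \<longleftrightarrow> (\<forall>e\<in>edges g. e \<subseteq> verts g \<and> card e = 2)"

definition finite_simple_graph :: "'v ugraph \<Rightarrow> bool" where
  "finite_simple_graph g \<longleftrightarrow> simple_graph g \<and> finite (verts g)"

definition incident_edges :: "'v ugraph \<Rightarrow> 'v \<Rightarrow> 'v set set" where
  "incident_edges g v = {e \<in> edges g. v \<in> e}"

definition vdegree :: "'v ugraph \<Rightarrow> 'v \<Rightarrow> nat" where
  "vdegree g v = card (incident_edges g v)"

definition locally_finite_graph :: "'v ugraph \<Rightarrow> bool" where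
  "locally_finite_graph g \<longleftrightarrow> (\<forall>v\<in>verts g. finite (incident_edges g v))"

definition adj :: "'v ugraph \<Rightarrow> 'v \<Rightarrow> 'v \<Rightarrow> bool" where
  "adj g u v \<longleftrightarrow> {u, v} \<in> edges g"

definition graph_components :: "'v ugraph \<Rightarrow> 'v set set" where
  "graph_components g =
     verts g // {(u, v). u \<in> verts g \<and> v \<in> verts g \<and> (adj g)\<^sup>*\<^sup>* u v}"

definition connected_graph :: "'v ugraph \<Rightarrow> bool" where
  "connected_graph g \<longleftrightarrow> verts g \<noteq> {} \<and> (\<forall>u\<in>verts g. \<forall>v\<in>verts g. (adj g)\<^sup>*\<^sup>* u v)"

definition is_cycle :: "'v ugraph \<Rightarrow> 'v list \<Rightarrow> bool" where
  "is_cycle g vs \<longleftrightarrow> length vs \<ge> 3 \<and> distinct vs \<and> successively (adj g) vs \<and> adj g (last vs) (hd vs)"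

definition tree_graph :: "'v ugraph \<Rightarrow> bool" where
  "tree_graph g \<longleftrightarrow> connected_graph g \<and> (\<nexists>vs. is_cycle g vs)"

text \<open>The rooted r-neighbourhood of a vertex is the subgraph induced by the vertices
  at graph distance at most r from it.\<close>

definition nbhd_verts :: "'v ugraph \<Rightarrow> 'v \<Rightarrow> nat \<Rightarrow> 'v set" where
  "nbhd_verts g x r = {v \<in> verts g. \<exists>k\<le>r. ((adj g) ^^ k) x v}"

definition nbhd :: "'v ugraph \<Rightarrow> 'v \<Rightarrow> nat \<Rightarrow> 'v ugraph" where
  "nbhd g x r = UGraph (nbhd_verts g x r) {e \<in> edges g. e \<subseteq> nbhd_verts g x r}"

definition rooted_iso :: "'u ugraph \<Rightarrow> 'u \<Rightarrow> 'v ugraph \<Rightarrow> 'v \<Rightarrow> bool" where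
  "rooted_iso g x h y \<longleftrightarrow>
     (\<exists>f. bij_betw f (verts g) (verts h) \<and> f x = y \<and>
          (\<forall>u\<in>verts g. \<forall>v\<in>verts g. adj g u v \<longleftrightarrow> adj h (f u) (f v)))"

text \<open>The configuration \<open>\<omega>\<close> is a 0/1-valued function on the edge set; the clusters are the
  components of the spanning subgraph of open edges.\<close>

definition Z_rc :: "'v ugraph \<Rightarrow> real \<Rightarrow> real \<Rightarrow> real \<Rightarrow> real" where
  "Z_rc g q w B =
     (\<Sum>\<omega> \<in> edges g \<rightarrow>\<^sub>E {0, 1::nat}.
        (\<Prod>e\<in>edges g. w ^ \<omega> e) *
        (\<Prod>C\<in>graph_components (UGraph (verts g) {e \<in> edges g. \<omega> e = 1}).
            1 + (q - 1) * exp (- B * real (card C))))"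

text \<open>For an edge \<open>e = {u, v}\<close> the product of \<open>\<sigma>\<close> over \<open>e\<close> is \<open>\<sigma> u * \<sigma> v\<close>, since
  u and v are distinct.\<close>

definition Z_eIsing :: "'v ugraph \<Rightarrow> real \<Rightarrow> real \<Rightarrow> real \<Rightarrow> real" where
  "Z_eIsing g \<beta> k h =
     (\<Sum>\<sigma> \<in> verts g \<rightarrow>\<^sub>E {-1, 1::real}.
        exp (\<beta> * (\<Sum>e\<in>edges g. \<Prod>v\<in>e. \<sigma> v)
             + (\<Sum>v\<in>verts g. (k * real (vdegree g v) + h) * \<sigma> v)))"

definition tendsto_in_prob :: "'w measure \<Rightarrow> (nat \<Rightarrow> 'w \<Rightarrow> real) \<Rightarrow> ('w \<Rightarrow> real) \<Rightarrow> bool" where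
  "tendsto_in_prob M X Y \<longleftrightarrow>
     (\<forall>\<epsilon>>0. (\<lambda>n. measure M {\<omega> \<in> space M. \<bar>X n \<omega> - Y \<omega>\<bar> > \<epsilon>}) \<longlonglongrightarrow> 0)"

text \<open>A random finite graph is a random element of the set of finite simple graphs with the
  discrete sigma-algebra; its vertex set may itself be random.\<close>

definition random_graph :: "'w measure \<Rightarrow> ('w \<Rightarrow> 'v ugraph) \<Rightarrow> bool" where
  "random_graph M g \<longleftrightarrow> g \<in> M \<rightarrow>\<^sub>M count_space {a. finite_simple_graph a}"

text \<open>The sigma-algebra on rooted locally finite graphs is the one of the local topology, generated
  by the isomorphism types of the neighbourhoods of the root. Every finite rooted graph is
  isomorphic to one with vertices in the natural numbers. Connectedness is not required here;
  it follows almost surely when the graph is almost surely a tree.\<close>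

definition random_rooted_graph :: "'u measure \<Rightarrow> ('u \<Rightarrow> 'v ugraph) \<Rightarrow> ('u \<Rightarrow> 'v) \<Rightarrow> bool" where
  "random_rooted_graph N g ro \<longleftrightarrow>
     (\<forall>x\<in>space N. simple_graph (g x) \<and> locally_finite_graph (g x) \<and> ro x \<in> verts (g x)) \<and>
     (\<forall>r (H :: nat ugraph) z. finite_simple_graph H \<and> z \<in> verts H \<longrightarrow>
        {x \<in> space N. rooted_iso (nbhd (g x) (ro x) r) (ro x) H z} \<in> sets N)"

text \<open>The law of the degree of a uniformly random vertex of a random graph, averaged over
  both the graph and the vertex.\<close>

definition degree_law :: "'w measure \<Rightarrow> ('w \<Rightarrow> 'v ugraph) \<Rightarrow> real measure" where
  "degree_law M g =
     M \<bind> (\<lambda>\<omega>. distr (measure_pmf (pmf_of_set (verts (g \<omega>)))) borel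
                    (\<lambda>v. real (vdegree (g \<omega>) v)))"

text \<open>The limiting random variable D enters only through its law \<open>\<mu>\<close>.\<close>

definition uniformly_sparse :: "'w measure \<Rightarrow> (nat \<Rightarrow> 'w \<Rightarrow> 'v ugraph) \<Rightarrow> bool" where
  "uniformly_sparse M G \<longleftrightarrow>
     (\<exists>\<mu>. real_distribution \<mu> \<and>
          weak_conv_m (\<lambda>n. degree_law M (G n)) \<mu> \<and>
          integrable \<mu> (\<lambda>x. x) \<and>
          (\<lambda>n. \<integral>x. x \<partial>degree_law M (G n)) \<longlonglongrightarrow> (\<integral>x. x \<partial>\<mu>))"

definition converges_locally_in_prob ::
  "'w measure \<Rightarrow> (nat \<Rightarrow> 'w \<Rightarrow> 'v ugraph) \<Rightarrow> 'u measure \<Rightarrow> ('u \<Rightarrow> 'a ugraph) \<Rightarrow> ('u \<Rightarrow> 'a) \<Rightarrow> bool" where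
  "converges_locally_in_prob M G N \<Gamma> ro \<longleftrightarrow>
     (\<forall>r (H :: nat ugraph) z. finite_simple_graph H \<and> z \<in> verts H \<longrightarrow>
        tendsto_in_prob M
          (\<lambda>n \<omega>. real (card {v \<in> verts (G n \<omega>). rooted_iso (nbhd (G n \<omega>) v r) v H z})
                   / real (card (verts (G n \<omega>))))
          (\<lambda>_. measure N {x \<in> space N. rooted_iso (nbhd (\<Gamma> x) (ro x) r) (ro x) H z}))"

definition locally_tree_like ::
  "'w measure \<Rightarrow> (nat \<Rightarrow> 'w \<Rightarrow> 'v ugraph) \<Rightarrow> 'u measure \<Rightarrow> ('u \<Rightarrow> 'a ugraph) \<Rightarrow> ('u \<Rightarrow> 'a) \<Rightarrow> bool" where
  "locally_tree_like M G N \<Gamma> ro \<longleftrightarrow>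
     uniformly_sparse M G \<and>
     random_rooted_graph N \<Gamma> ro \<and>
     (AE x in N. tree_graph (\<Gamma> x)) \<and>
     converges_locally_in_prob M G N \<Gamma> ro"

end

theory Submission
  imports Defs "HOL-Library.Transitive_Closure_Table"
begin

text \<open>
Expand the factor \<open>1 + (q - 1) * exp (- B * |C|)\<close> of each cluster as a choice of one of two colours. If
all clusters were trees, then \<open>q - 1\<close> could be written as \<open>(q - 1)\<close> to the power \<open>|C| - |E(C)|\<close>, where
\<open>E(C)\<close> is the set of open edges in \<open>C\<close>, so that the weight of an edge configuration given the colouring
would be a product over vertices and edges. Summing over the edge configurations first leaves a spin
model with pair interactions, which is the extended Ising model. For every finite graph \<open>g\<close> the random
cluster partition function with the modified cluster weights, here called \<open>Z_rank2\<close>, therefore equals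
the extended Ising partition function up to the factor
\<open>exp (\<beta> * |E| + |V| / 2 * ln ((q - 1) * exp (- B)))\<close>; this is \<open>Z_rank2_eq_Z_eIsing\<close>.

Clusters need not be trees, but in a graph that is locally a tree few of them contain a cycle. As \<open>q - 1 \<ge> 1\<close> and a connected graph has Euler
characteristic at most 1, the modified weights are at most the original ones. They differ only on
clusters that contain a cycle, and there the ratio is at most \<open>q\<close>. A cluster with a cycle either
has at least \<open>r\<close> vertices, which happens at most \<open>|V| / r\<close> times, or it lies in the set of vertices whose
\<open>r\<close>-neighbourhood contains a cycle. Hence \<open>Z_rc\<close> lies between \<open>Z_rank2\<close> and \<open>Z_rank2\<close> times a power of
\<open>q\<close> whose exponent is \<open>|V| / r\<close> plus the number of these vertices (\<open>Z_rc_bounds\<close>).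

Two facts about the random graphs remain. The proportion of vertices whose \<open>r\<close>-neighbourhood contains a
cycle tends to 0 in probability (\<open>cyclic_fraction_tendsto_0\<close>), since the local limit is a tree. The number
of edges per vertex tends in probability to half of the mean root degree
(\<open>mean_degree_tendsto_in_prob\<close>), since convergence of the mean degree prevents a loss of mass to
vertices of large degree. Both rest on \<open>local_average_tendsto_in_prob\<close>: averages of bounded functions
of the neighbourhood converge.
\<close>

section \<open>Components, paths and cycles\<close>

lemma adj_sym: "adj g u v \<Longrightarrow> adj g v u"
  by (simp add: adj_def insert_commute)

lemma adj_in_verts:
  assumes "simple_graph g" "adj g u v"
  shows "u \<in> verts g" "v \<in> verts g" "u \<noteq> v"
  using assms unfolding simple_graph_def adj_def by fastforce+

lemma edgeE:
  assumes "simple_graph g" "e \<in> edges g"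
  obtains u v where "e = {u, v}" "u \<noteq> v" "adj g u v"
  using assms unfolding simple_graph_def adj_def by (metis card_2_iff)

lemma finite_edges: "finite_simple_graph g \<Longrightarrow> finite (edges g)"
  unfolding finite_simple_graph_def simple_graph_def
  by (meson PowI finite_Pow_iff finite_subset subsetI)

lemma vdegree_eq_card_neighbours:
  assumes "simple_graph g"
  shows "vdegree g v = card {u. adj g v u}"
proof -
  have "bij_betw (\<lambda>u. {v, u}) {u. adj g v u} (incident_edges g v)"
    unfolding bij_betw_def
  proof
    show "inj_on (\<lambda>u. {v, u}) {u. adj g v u}"
      by (auto simp: inj_on_def doubleton_eq_iff)
    show "(\<lambda>u. {v, u}) ` {u. adj g v u} = incident_edges g v"
    proof
      show "incident_edges g v \<subseteq> (\<lambda>u. {v, u}) ` {u. adj g v u}"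
      proof
        fix e assume "e \<in> incident_edges g v"
        then have e: "e \<in> edges g" "v \<in> e" by (auto simp: incident_edges_def)
        obtain a b where ab: "e = {a, b}" "adj g a b" using assms e(1) by (rule edgeE)
        show "e \<in> (\<lambda>u. {v, u}) ` {u. adj g v u}"
          using ab e(2) adj_sym[of g a b] by (auto simp: insert_commute)
      qed
    qed (auto simp: incident_edges_def adj_def)
  qed
  then show ?thesis unfolding vdegree_def by (metis bij_betw_same_card)
qed

lemma rtranclp_adj_sym: "(adj g)\<^sup>*\<^sup>* u v \<Longrightarrow> (adj g)\<^sup>*\<^sup>* v u"
proof (induction rule: rtranclp_induct)
  case (step y z)
  then show ?case using adj_sym[OF step(2)] by (meson converse_rtranclp_into_rtranclp)
qed simp

lemma connected_equiv:
  "equiv (verts g) {(u, v). u \<in> verts g \<and> v \<in> verts g \<and> (adj g)\<^sup>*\<^sup>* u v}"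
  by (auto simp: equiv_def refl_on_def sym_def trans_def intro: rtranclp_adj_sym)

lemma Union_graph_components: "\<Union>(graph_components g) = verts g"
  unfolding graph_components_def by (rule Union_quotient[OF connected_equiv])

lemma graph_components_disjoint:
  "C \<in> graph_components g \<Longrightarrow> C' \<in> graph_components g \<Longrightarrow> C = C' \<or> C \<inter> C' = {}"
  unfolding graph_components_def by (rule quotient_disj[OF connected_equiv])

lemma graph_components_nonempty: "C \<in> graph_components g \<Longrightarrow> C \<noteq> {}"
  unfolding graph_components_def by (rule in_quotient_imp_non_empty[OF connected_equiv])

lemma graph_components_subset: "C \<in> graph_components g \<Longrightarrow> C \<subseteq> verts g"
  unfolding graph_components_def by (rule in_quotient_imp_subset[OF connected_equiv])

lemma graph_components_connected:
  "C \<in> graph_components g \<Longrightarrow> u \<in> C \<Longrightarrow> v \<in> C \<Longrightarrow> (adj g)\<^sup>*\<^sup>* u v"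
  unfolding graph_components_def
  using in_quotient_imp_in_rel[OF connected_equiv, of C g u v] by auto

lemma graph_components_closed:
  assumes "simple_graph g" "C \<in> graph_components g" "u \<in> C" "(adj g)\<^sup>*\<^sup>* u v"
  shows "v \<in> C"
proof -
  have "u \<in> verts g" using graph_components_subset assms by blast
  from assms(4) have "v \<in> verts g"
    using \<open>u \<in> verts g\<close> adj_in_verts(2)[OF assms(1)] by (cases rule: rtranclp.cases) auto
  then show ?thesis
    using in_quotient_imp_closed[OF connected_equiv, of C g u v] assms \<open>u \<in> verts g\<close>
    unfolding graph_components_def by auto
qed

lemma finite_graph_components: "finite (verts g) \<Longrightarrow> finite (graph_components g)"
  by (metis Union_graph_components finite_UnionD)

lemma rtrancl_path_successively:
  "rtrancl_path r x xs y \<Longrightarrow> successively r (x # xs) \<and> last (x # xs) = y"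
proof (induction rule: rtrancl_path.induct)
  case (step x y ys z)
  then show ?case by (cases ys) auto
qed auto

lemma rtrancl_path_reachable:
  "rtrancl_path r x xs y \<Longrightarrow> u \<in> set (x # xs) \<Longrightarrow> r\<^sup>*\<^sup>* x u"
proof (induction rule: rtrancl_path.induct)
  case (step x y ys z)
  then show ?case
    by (metis converse_rtranclp_into_rtranclp rtranclp.rtrancl_refl set_ConsD)
qed auto

lemma rtrancl_path_relpow: "rtrancl_path r x xs y \<Longrightarrow> (r ^^ length xs) x y"
proof (induction rule: rtrancl_path.induct)
  case (step x y ys z)
  then show ?case by (metis length_Cons relpowp_Suc_I2)
qed auto

lemma distinct_path:
  assumes "r\<^sup>*\<^sup>* x y"
  obtains xs where "rtrancl_path r x xs y" "distinct (x # xs)"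
  using assms rtrancl_path_distinct unfolding rtranclp_eq_rtrancl_path by metis

text \<open>Two vertices of a component of size at most \<open>r\<close> are at distance at most \<open>r\<close>.\<close>

lemma component_distance:
  assumes "simple_graph g" "C \<in> graph_components g" "finite C" "u \<in> C" "v \<in> C"
  shows "\<exists>k\<le>card C. (adj g ^^ k) u v"
proof -
  obtain xs where xs: "rtrancl_path (adj g) u xs v" "distinct (u # xs)"
    using distinct_path graph_components_connected[OF assms(2,4,5)] by metis
  have "set (u # xs) \<subseteq> C"
    using rtrancl_path_reachable[OF xs(1)] graph_components_closed[OF assms(1,2,4)] by blast
  then have "length (u # xs) \<le> card C"
    using distinct_card[OF xs(2)] card_mono[OF assms(3)] by metis
  then show ?thesis using rtrancl_path_relpow[OF xs(1)] by (intro exI[of _ "length xs"]) simp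
qed

text \<open>An edge whose removal does not disconnect its endpoints closes a cycle.\<close>

lemma cycle_through_edge:
  assumes "adj g a b" "a \<noteq> b" "(adj (UGraph V (edges g - {{a, b}})))\<^sup>*\<^sup>* a b"
  shows "\<exists>vs. is_cycle g vs \<and> (\<forall>u\<in>set vs. (adj g)\<^sup>*\<^sup>* a u)"
proof -
  let ?r = "adj (UGraph V (edges g - {{a, b}}))"
  obtain xs where xs: "rtrancl_path ?r a xs b" "distinct (a # xs)"
    using distinct_path assms(3) by metis
  have le: "adj g u v" if "?r u v" for u v using that by (auto simp: adj_def)
  have sl: "successively ?r (a # xs)" "last (a # xs) = b"
    using rtrancl_path_successively[OF xs(1)] by auto
  have "length (a # xs) \<ge> 3"
  proof (rule ccontr)
    assume "\<not> ?thesis"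
    then consider "xs = []" | x where "xs = [x]"
      by (cases xs; cases "tl xs") auto
    then show False
      using sl assms(2) by cases (auto simp: adj_def)
  qed
  moreover have "successively (adj g) (a # xs)"
    using sl(1) le successively_mono by metis
  moreover have "adj g (last (a # xs)) (hd (a # xs))"
    using sl(2) adj_sym[OF assms(1)] by simp
  moreover have "(adj g)\<^sup>*\<^sup>* a u" if "u \<in> set (a # xs)" for u
    using rtrancl_path_reachable[OF xs(1) that] le mono_rtranclp[of ?r "adj g"] by blast
  ultimately show ?thesis using xs(2) unfolding is_cycle_def by metis
qed

text \<open>The Euler characteristic \<open>|C| - |E(C)|\<close> of a component is at most 1, with equality if the
  component contains no cycle. The vertices other than a root inject into the edges by joining each
  to a parent, that is, a neighbour one step closer to the root. An edge outside the image closes a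
  cycle with the paths of parents.\<close>

lemma component_edges:
  assumes g: "simple_graph g" and C: "C \<in> graph_components g" and fin: "finite C"
  shows component_card_le: "card C \<le> card {e \<in> edges g. e \<subseteq> C} + 1"
    and component_cycle: "card C \<noteq> card {e \<in> edges g. e \<subseteq> C} + 1 \<Longrightarrow>
      \<exists>vs. is_cycle g vs \<and> set vs \<subseteq> C"
proof -
  let ?E = "{e \<in> edges g. e \<subseteq> C}"
  have finE: "finite ?E" using fin by (auto intro: finite_subset[of _ "Pow C"])
  obtain x where x: "x \<in> C" using graph_components_nonempty[OF C] by blast
  \<comment> \<open>the distance of \<open>v\<close> from the root \<open>x\<close>\<close>
  define d where "d v = (LEAST n. (adj g ^^ n) x v)" for v
  have d: "(adj g ^^ d v) x v" if "v \<in> C" for v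
  proof -
    have "(adj g)\<^sup>*\<^sup>* x v" using graph_components_connected[OF C x that] .
    then obtain n where "(adj g ^^ n) x v" by (auto simp: rtranclp_power)
    then show ?thesis unfolding d_def by (rule LeastI)
  qed
  have "\<exists>p. adj g p v \<and> p \<in> C \<and> Suc (d p) = d v" if v: "v \<in> C - {x}" for v
  proof -
    have "d v \<noteq> 0" using d[of v] v by (metis DiffE relpowp_0_E singletonI)
    then obtain m where m: "d v = Suc m" by (cases "d v") auto
    with d[of v] v obtain p where p: "(adj g ^^ m) x p" "adj g p v" by auto
    have pC: "p \<in> C" using graph_components_closed[OF g C, of v p] adj_sym[OF p(2)] v by auto
    have "d p \<le> m" unfolding d_def using p(1) by (rule Least_le)
    moreover have "d v \<le> Suc (d p)" unfolding d_def[of v]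
      by (rule Least_le) (use d[OF pC] p(2) in auto)
    ultimately show ?thesis using p(2) pC m by auto
  qed
  then obtain p where p: "\<And>v. v \<in> C - {x} \<Longrightarrow> adj g (p v) v \<and> p v \<in> C \<and> Suc (d (p v)) = d v"
    by metis
  let ?f = "\<lambda>v. {p v, v}"
  have inj: "inj_on ?f (C - {x})"
  proof (rule inj_onI)
    fix u v assume uv: "u \<in> C - {x}" "v \<in> C - {x}" "{p u, u} = {p v, v}"
    show "u = v"
    proof (rule ccontr)
      assume "u \<noteq> v"
      then have "u = p v" "v = p u" using uv(3) by (auto simp: doubleton_eq_iff)
      then show False using p[OF uv(1)] p[OF uv(2)] by (metis Suc_n_not_le_n le_SucI le_refl)
    qed
  qed
  have im: "?f ` (C - {x}) \<subseteq> ?E" using p by (auto simp: adj_def)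
  have card_im: "card (?f ` (C - {x})) = card C - 1"
    using card_image[OF inj] x fin by simp
  have pos: "card C > 0" using x fin by (auto simp: card_gt_0_iff)
  show le: "card C \<le> card ?E + 1" using card_mono[OF finE im] card_im by simp
  assume "card C \<noteq> card ?E + 1"
  then have "?f ` (C - {x}) \<noteq> ?E" using card_im pos by auto
  then obtain e where e: "e \<in> edges g" "e \<subseteq> C" "e \<notin> ?f ` (C - {x})" using im by blast
  obtain a b where ab: "e = {a, b}" "a \<noteq> b" "adj g a b" using edgeE[OF g e(1)] .
  let ?g = "UGraph (verts g) (edges g - {{a, b}})"
  \<comment> \<open>the vertices of \<open>C\<close> are connected to \<open>x\<close> by parent edges alone, hence without \<open>e\<close>\<close>
  have reach: "(adj ?g)\<^sup>*\<^sup>* x v" if "v \<in> C" for v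
    using that
  proof (induction "d v" arbitrary: v rule: less_induct)
    case less
    show ?case
    proof (cases "v = x")
      case False
      then have v: "v \<in> C - {x}" using less.prems by auto
      have "{p v, v} \<noteq> {a, b}" using imageI[OF v, of ?f] e(3) ab(1) by auto
      then have "adj ?g (p v) v" using p[OF v] by (auto simp: adj_def)
      moreover have "(adj ?g)\<^sup>*\<^sup>* x (p v)" using less.hyps[of "p v"] p[OF v] by simp
      ultimately show ?thesis by simp
    qed simp
  qed
  have "a \<in> C" "b \<in> C" using e(2) ab(1) by auto
  then have "(adj ?g)\<^sup>*\<^sup>* a b"
    using rtranclp_trans[OF rtranclp_adj_sym[OF reach] reach] by blast
  then obtain vs where "is_cycle g vs" "\<forall>u\<in>set vs. (adj g)\<^sup>*\<^sup>* a u"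
    using cycle_through_edge[OF ab(3,2)] by blast
  then show "\<exists>vs. is_cycle g vs \<and> set vs \<subseteq> C"
    using graph_components_closed[OF g C \<open>a \<in> C\<close>] by blast
qed

section \<open>The rank-two partition function\<close>

text \<open>The weight \<open>(q - 1)\<close> to the power \<open>|C| - |E(C)|\<close>, times \<open>exp (- B * |C|)\<close>. It agrees with
  the weight \<open>(q - 1) * exp (- B * |C|)\<close> of the random cluster model on components that are trees.
  The two factors are separated so that all exponents are natural numbers.\<close>

definition euler_weight :: "real \<Rightarrow> real \<Rightarrow> 'v ugraph \<Rightarrow> 'v set \<Rightarrow> real" where
  "euler_weight q B g C =
     ((q - 1) * exp (- B)) ^ card C * (1 / (q - 1)) ^ card {e \<in> edges g. e \<subseteq> C}"

text \<open>The partition function \<open>Z_rc\<close> with the weight of every cluster replaced by its Euler weight;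
  \<open>F\<close> is the set of open edges.\<close>

definition Z_rank2 :: "'v ugraph \<Rightarrow> real \<Rightarrow> real \<Rightarrow> real \<Rightarrow> real" where
  "Z_rank2 g q w B =
     (\<Sum>F\<in>Pow (edges g). w ^ card F *
        (\<Prod>C\<in>graph_components (UGraph (verts g) F). 1 + euler_weight q B (UGraph (verts g) F) C))"

text \<open>The vertices whose \<open>r\<close>-neighbourhood contains a cycle, that is, is not a tree.\<close>

definition cyclic_nbhd_verts :: "'v ugraph \<Rightarrow> nat \<Rightarrow> 'v set" where
  "cyclic_nbhd_verts g r = {v \<in> verts g. \<exists>vs. is_cycle (nbhd g v r) vs}"

lemma sum_PiE_two_values:
  assumes "finite A" "a \<noteq> b"
  shows "(\<Sum>f \<in> A \<rightarrow>\<^sub>E {a, b}. \<phi> f) = (\<Sum>U\<in>Pow A. \<phi> (\<lambda>x\<in>A. if x \<in> U then b else a))"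
proof (rule sum.reindex_bij_witness[where j = "\<lambda>f. {x \<in> A. f x = b}"
    and i = "\<lambda>U. \<lambda>x\<in>A. if x \<in> U then b else a"])
  fix f assume "f \<in> A \<rightarrow>\<^sub>E {a, b}"
  then show "(\<lambda>x\<in>A. if x \<in> {x \<in> A. f x = b} then b else a) = f"
    using assms(2) by (fastforce simp: PiE_def extensional_def restrict_def)
  then show "\<phi> (\<lambda>x\<in>A. if x \<in> {x \<in> A. f x = b} then b else a) = \<phi> f" by simp
qed (use assms(2) in auto)

lemma Z_rc_eq_subsets:
  assumes "finite_simple_graph g"
  shows "Z_rc g q w B = (\<Sum>F\<in>Pow (edges g). w ^ card F *
     (\<Prod>C\<in>graph_components (UGraph (verts g) F). 1 + (q - 1) * exp (- B * real (card C))))"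
  unfolding Z_rc_def
proof (subst sum_PiE_two_values[OF finite_edges[OF assms]], simp, rule sum.cong[OF refl])
  fix F assume F: "F \<in> Pow (edges g)"
  have "(\<Prod>e\<in>edges g. w ^ (\<lambda>x\<in>edges g. if x \<in> F then 1 else 0::nat) e)
      = (\<Prod>e\<in>edges g. if e \<in> F then w else 1)" by (intro prod.cong) auto
  also have "\<dots> = (\<Prod>e\<in>F. w)"
    using F finite_edges[OF assms] by (subst prod.inter_restrict[symmetric]) (auto simp: Int_absorb1)
  finally have 1: "(\<Prod>e\<in>edges g. w ^ (\<lambda>x\<in>edges g. if x \<in> F then 1 else 0::nat) e) = w ^ card F"
    by simp
  have 2: "{e \<in> edges g. (\<lambda>x\<in>edges g. if x \<in> F then 1 else 0::nat) e = 1} = F"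
    using F by auto
  show "(\<Prod>e\<in>edges g. w ^ (\<lambda>x\<in>edges g. if x \<in> F then 1 else 0::nat) e) *
     (\<Prod>C\<in>graph_components
        (UGraph (verts g) {e \<in> edges g. (\<lambda>x\<in>edges g. if x \<in> F then 1 else 0::nat) e = 1}).
        1 + (q - 1) * exp (- B * real (card C))) =
     w ^ card F *
     (\<Prod>C\<in>graph_components (UGraph (verts g) F). 1 + (q - 1) * exp (- B * real (card C)))"
    unfolding 1 2 ..
qed

text \<open>The upper bound uses \<open>q - 1 \<ge> 1\<close>: the Euler characteristic of a component is at most 1.\<close>

lemma euler_weight_bounds:
  assumes g: "finite_simple_graph g" and C: "C \<in> graph_components g" and q: "q \<ge> 2"
  shows euler_weight_pos: "euler_weight q B g C > 0"
    and euler_weight_le: "euler_weight q B g C \<le> (q - 1) * exp (- B * real (card C))"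
    and euler_weight_tree: "\<nexists>vs. is_cycle g vs \<and> set vs \<subseteq> C \<Longrightarrow>
      euler_weight q B g C = (q - 1) * exp (- B * real (card C))"
proof -
  have sg: "simple_graph g" and fC: "finite C"
    using g graph_components_subset[OF C] finite_subset unfolding finite_simple_graph_def by auto
  define m where "m = card {e \<in> edges g. e \<subseteq> C}"
  have le: "card C \<le> m + 1" unfolding m_def by (rule component_card_le[OF sg C fC])
  have eq: "euler_weight q B g C = exp (- B * real (card C)) * ((q - 1) ^ card C / (q - 1) ^ m)"
    unfolding euler_weight_def m_def
    by (simp add: power_mult_distrib power_divide mult_ac flip: exp_of_nat_mult)
  show "euler_weight q B g C > 0" unfolding eq using q by simp
  have "(q - 1) ^ card C \<le> (q - 1) ^ (m + 1)" using le q by (intro power_increasing) auto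
  then have "(q - 1) ^ card C / (q - 1) ^ m \<le> q - 1" using q by (simp add: field_simps)
  then have "exp (- B * real (card C)) * ((q - 1) ^ card C / (q - 1) ^ m)
      \<le> exp (- B * real (card C)) * (q - 1)" by (intro mult_left_mono) auto
  then show "euler_weight q B g C \<le> (q - 1) * exp (- B * real (card C))"
    unfolding eq by (simp only: mult.commute)
  assume "\<nexists>vs. is_cycle g vs \<and> set vs \<subseteq> C"
  then have "card C = m + 1" using component_cycle[OF sg C fC] unfolding m_def by blast
  then show "euler_weight q B g C = (q - 1) * exp (- B * real (card C))"
    unfolding eq using q by simp
qed

lemma is_cycle_mono:
  assumes "is_cycle g vs" "\<And>u v. u \<in> set vs \<Longrightarrow> v \<in> set vs \<Longrightarrow> adj g u v \<Longrightarrow> adj g' u v"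
  shows "is_cycle g' vs"
proof -
  have ne: "vs \<noteq> []" using assms(1) by (auto simp: is_cycle_def)
  have "successively (adj g') vs"
    using assms unfolding is_cycle_def by (intro successively_mono[of "adj g" vs "adj g'"]) auto
  moreover have "adj g' (last vs) (hd vs)"
    using assms ne unfolding is_cycle_def by auto
  ultimately show ?thesis using assms(1) unfolding is_cycle_def by auto
qed

text \<open>A component with at most \<open>r\<close> vertices lies in the \<open>r\<close>-neighbourhood of each of its vertices.\<close>

lemma cyclic_component_vertex:
  assumes g: "finite_simple_graph g" and F: "F \<subseteq> edges g"
    and C: "C \<in> graph_components (UGraph (verts g) F)"
    and cyc: "is_cycle (UGraph (verts g) F) vs" "set vs \<subseteq> C" and r: "card C \<le> r"
  shows "C \<subseteq> cyclic_nbhd_verts g r"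
proof
  let ?h = "UGraph (verts g) F"
  have sh: "simple_graph ?h" using g F unfolding finite_simple_graph_def simple_graph_def by auto
  have Cv: "C \<subseteq> verts g" using graph_components_subset[OF C] by simp
  have fC: "finite C" using Cv g finite_subset unfolding finite_simple_graph_def by auto
  have adj: "adj ?h u v \<Longrightarrow> adj g u v" for u v using F by (auto simp: adj_def)
  fix v assume v: "v \<in> C"
  have "C \<subseteq> nbhd_verts g v r"
  proof
    fix u assume u: "u \<in> C"
    obtain k where "k \<le> card C" "(adj ?h ^^ k) v u" using component_distance[OF sh C fC v u] by blast
    moreover have "(adj g ^^ k) v u" using \<open>(adj ?h ^^ k) v u\<close> adj relpowp_mono by metis
    ultimately show "u \<in> nbhd_verts g v r" using r u Cv unfolding nbhd_verts_def
      by (intro CollectI conjI exI[of _ k]) auto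
  qed
  then have "is_cycle (nbhd g v r) vs"
    using cyc(2) F by (intro is_cycle_mono[OF cyc(1)]) (auto simp: nbhd_def adj_def)
  then show "v \<in> cyclic_nbhd_verts g r" using v Cv unfolding cyclic_nbhd_verts_def by blast
qed

lemma card_disjoint_sets_le:
  assumes "finite A" "\<And>C. C \<in> S \<Longrightarrow> C \<subseteq> A" "\<And>C C'. C \<in> S \<Longrightarrow> C' \<in> S \<Longrightarrow> C \<noteq> C' \<Longrightarrow> C \<inter> C' = {}"
    and "\<And>C. C \<in> S \<Longrightarrow> m \<le> card C"
  shows "m * card S \<le> card A"
proof -
  have fS: "finite S" using assms(1,2) by (intro finite_subset[of S "Pow A"]) auto
  have "m * card S = (\<Sum>C\<in>S. m)" by simp
  also have "\<dots> \<le> (\<Sum>C\<in>S. card C)" using assms(4) by (intro sum_mono) auto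
  also have "\<dots> = card (\<Union>S)"
    using assms by (subst card_Union_disjoint) (auto simp: pairwise_def disjnt_def intro: finite_subset)
  also have "\<dots> \<le> card A" using assms by (intro card_mono) auto
  finally show ?thesis .
qed

text \<open>Few components contain a cycle: at most \<open>n / r\<close> components have \<open>r\<close> or more vertices, and a
  smaller component with a cycle takes up a vertex whose \<open>r\<close>-neighbourhood contains a cycle.\<close>

lemma card_cyclic_components_le:
  assumes g: "finite_simple_graph g" and F: "F \<subseteq> edges g" and r: "r \<ge> 1"
  defines "h \<equiv> UGraph (verts g) F"
  shows "real (card {C \<in> graph_components h. \<exists>vs. is_cycle h vs \<and> set vs \<subseteq> C})
    \<le> real (card (verts g)) / real r + real (card (cyclic_nbhd_verts g r))"
proof -
  let ?S = "{C \<in> graph_components h. \<exists>vs. is_cycle h vs \<and> set vs \<subseteq> C}"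
  let ?L = "{C \<in> ?S. r \<le> card C}" and ?K = "{C \<in> ?S. card C < r}"
  have fv: "finite (verts g)" using g unfolding finite_simple_graph_def by auto
  have disj: "C \<inter> C' = {}" if "C \<in> graph_components h" "C' \<in> graph_components h" "C \<noteq> C'" for C C'
    using graph_components_disjoint that by blast
  have sub: "C \<subseteq> verts g" "card C \<ge> 1" if "C \<in> graph_components h" for C
  proof -
    show "C \<subseteq> verts g" using graph_components_subset[OF that] unfolding h_def by simp
    then show "card C \<ge> 1"
      using graph_components_nonempty[OF that] fv finite_subset by (auto simp: Suc_le_eq card_gt_0_iff)
  qed
  have fS: "finite ?S" using finite_graph_components[of h] fv unfolding h_def by simp
  have "r * card ?L \<le> card (verts g)"
    by (rule card_disjoint_sets_le[OF fv]) (use sub disj in auto)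
  then have "real r * real (card ?L) \<le> real (card (verts g))" 
    using of_nat_mono[where 'a = real] by fastforce
  then have L: "real (card ?L) \<le> real (card (verts g)) / real r" using r by (simp add: field_simps)
  have "1 * card ?K \<le> card (cyclic_nbhd_verts g r)"
  proof (rule card_disjoint_sets_le)
    show "finite (cyclic_nbhd_verts g r)" using fv unfolding cyclic_nbhd_verts_def by simp
    show "C \<subseteq> cyclic_nbhd_verts g r" if "C \<in> ?K" for C
      using that cyclic_component_vertex[OF g F, of C] less_imp_le unfolding h_def by blast
  qed (use sub disj in auto)
  moreover have "card ?S \<le> card ?L + card ?K"
  proof -
    have "?S = ?L \<union> ?K" by auto
    then have "card ?S = card (?L \<union> ?K)" by (rule arg_cong)
    also have "\<dots> \<le> card ?L + card ?K" by (rule card_Un_le)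
    finally show ?thesis .
  qed
  ultimately show ?thesis using L by linarith
qed

lemma Z_rank2_pos:
  assumes g: "finite_simple_graph g" and q: "q \<ge> 2" and w: "w \<ge> 0"
  shows "Z_rank2 g q w B > 0"
proof -
  let ?t = "\<lambda>F. w ^ card F *
        (\<Prod>C\<in>graph_components (UGraph (verts g) F). 1 + euler_weight q B (UGraph (verts g) F) C)"
  have pos: "(\<Prod>C\<in>graph_components (UGraph (verts g) F). 1 + euler_weight q B (UGraph (verts g) F) C) > 0"
    if "F \<subseteq> edges g" for F
  proof (rule prod_pos)
    fix C assume "C \<in> graph_components (UGraph (verts g) F)"
    moreover have "finite_simple_graph (UGraph (verts g) F)"
      using g that unfolding finite_simple_graph_def simple_graph_def by auto
    ultimately show "1 + euler_weight q B (UGraph (verts g) F) C > 0"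
      using euler_weight_pos[OF _ _ q, of "UGraph (verts g) F" C B] by simp
  qed
  have "0 < ?t {}" using pos[of "{}"] by simp
  also have "\<dots> \<le> (\<Sum>F\<in>Pow (edges g). ?t F)"
    by (rule member_le_sum)
      (use w pos finite_edges[OF g] in \<open>simp_all add: mult_nonneg_nonneg less_imp_le\<close>)
  finally show ?thesis unfolding Z_rank2_def .
qed

text \<open>The two partition functions are compared term by term. Clusters that are trees have equal
  factors; on the others the factor \<open>1 + (q - 1) * exp (- B * |C|)\<close> is at most \<open>q\<close>, as \<open>B \<ge> 0\<close>, while
  the modified factor is at least 1.\<close>

lemma Z_rc_bounds:
  assumes g: "finite_simple_graph g" and q: "q \<ge> 2" and w: "w \<ge> 0" and B: "B \<ge> 0" and r: "r \<ge> 1"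
  shows "Z_rank2 g q w B \<le> Z_rc g q w B"
    and "Z_rc g q w B \<le>
      q powr (real (card (verts g)) / real r + real (card (cyclic_nbhd_verts g r))) * Z_rank2 g q w B"
proof -
  define N where "N = real (card (verts g)) / real r + real (card (cyclic_nbhd_verts g r))"
  let ?h = "\<lambda>F. UGraph (verts g) F"
  let ?a = "\<lambda>F. \<Prod>C\<in>graph_components (?h F). 1 + (q - 1) * exp (- B * real (card C))"
  let ?b = "\<lambda>F. \<Prod>C\<in>graph_components (?h F). 1 + euler_weight q B (?h F) C"
  have *: "?b F \<le> ?a F \<and> ?a F \<le> q powr N * ?b F" if F: "F \<subseteq> edges g" for F
  proof
    have fh: "finite_simple_graph (?h F)"
      using g F unfolding finite_simple_graph_def simple_graph_def by auto
    let ?S = "{C \<in> graph_components (?h F). \<exists>vs. is_cycle (?h F) vs \<and> set vs \<subseteq> C}"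
    have fin: "finite (graph_components (?h F))"
      using g by (intro finite_graph_components) (simp add: finite_simple_graph_def)
    note pos = euler_weight_pos[OF fh _ q, of _ B]
    note le = euler_weight_le[OF fh _ q, of _ B]
    show "?b F \<le> ?a F" using pos le by (intro prod_mono) (force intro: less_imp_le)
    have "?a F \<le> (\<Prod>C\<in>graph_components (?h F).
        (if C \<in> ?S then q else 1) * (1 + euler_weight q B (?h F) C))"
    proof (rule prod_mono, rule conjI)
      fix C assume C: "C \<in> graph_components (?h F)"
      show "0 \<le> 1 + (q - 1) * exp (- B * real (card C))" using q by simp
      show "1 + (q - 1) * exp (- B * real (card C)) \<le>
        (if C \<in> ?S then q else 1) * (1 + euler_weight q B (?h F) C)"
      proof (cases "C \<in> ?S")
        case True
        have "exp (- B * real (card C)) \<le> 1" using B by simp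
        then have "(q - 1) * exp (- B * real (card C)) \<le> (q - 1) * 1" using q by (intro mult_left_mono) auto
        moreover have "q * 1 \<le> q * (1 + euler_weight q B (?h F) C)"
          using pos[OF C] q by (intro mult_left_mono) auto
        ultimately show ?thesis using True by simp
      next
        case False
        then have acyc: "\<nexists>vs. is_cycle (?h F) vs \<and> set vs \<subseteq> C" using C by blast
        show ?thesis unfolding if_not_P[OF False] euler_weight_tree[OF fh C q acyc, of B] by simp
      qed
    qed
    also have "\<dots> = q ^ card ?S * ?b F"
    proof -
      have "(\<Prod>C\<in>graph_components (?h F). if C \<in> ?S then q else 1) = (\<Prod>C\<in>?S. q)"
      proof -
        have "graph_components (?h F) \<inter> ?S = ?S" by auto
        then show ?thesis using prod.inter_restrict[OF fin, of "\<lambda>_. q" ?S] by simp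
      qed
      then show ?thesis by (simp add: prod.distrib)
    qed
    also have "\<dots> \<le> q powr N * ?b F"
    proof (rule mult_right_mono)
      have "q ^ card ?S = q powr real (card ?S)" using q by (simp add: powr_realpow)
      also have "\<dots> \<le> q powr N"
        using q card_cyclic_components_le[OF g F r] unfolding N_def by (intro powr_mono) auto
      finally show "q ^ card ?S \<le> q powr N" .
      show "0 \<le> ?b F" using pos by (intro prod_nonneg) (force intro: less_imp_le)
    qed
    finally show "?a F \<le> q powr N * ?b F" .
  qed
  show "Z_rank2 g q w B \<le> Z_rc g q w B"
    unfolding Z_rank2_def Z_rc_eq_subsets[OF g] using * w by (intro sum_mono mult_left_mono) auto
  have "Z_rc g q w B \<le> (\<Sum>F\<in>Pow (edges g). w ^ card F * (q powr N * ?b F))"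
    unfolding Z_rc_eq_subsets[OF g] using * w by (intro sum_mono mult_left_mono) auto
  then show "Z_rc g q w B \<le> q powr (real (card (verts g)) / real r + real (card (cyclic_nbhd_verts g r))) * Z_rank2 g q w B"
    unfolding Z_rank2_def N_def by (simp add: sum_distrib_left mult_ac)
qed

section \<open>Reduction to the extended Ising model\<close>

text \<open>The weight of an open edge when the vertices are split into \<open>U\<close> and its complement: \<open>p\<close> inside
  \<open>U\<close>, 1 outside \<open>U\<close>, and 0 between the two sides.\<close>

definition side_weight :: "real \<Rightarrow> 'v set \<Rightarrow> 'v set \<Rightarrow> real" where
  "side_weight p U e = (if e \<subseteq> U then p else if e \<inter> U = {} then 1 else 0)"

lemma union_of_components:
  assumes g: "simple_graph g" and U: "U \<subseteq> verts g"
    and closed: "\<And>e. e \<in> edges g \<Longrightarrow> e \<subseteq> U \<or> e \<inter> U = {}"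
  shows "\<Union>{C \<in> graph_components g. C \<subseteq> U} = U"
proof
  show "U \<subseteq> \<Union>{C \<in> graph_components g. C \<subseteq> U}"
  proof
    fix u assume u: "u \<in> U"
    then obtain C where C: "C \<in> graph_components g" "u \<in> C"
      using U Union_graph_components[of g] by blast
    have "v \<in> U" if "v \<in> C" for v
      using graph_components_connected[OF C that]
    proof (induction rule: rtranclp_induct)
      case (step y z)
      then show ?case using closed[of "{y, z}"] by (auto simp: adj_def)
    qed (rule u)
    then show "u \<in> \<Union>{C \<in> graph_components g. C \<subseteq> U}" using C by blast
  qed
qed auto

lemma edge_in_component:
  assumes g: "simple_graph g" and C: "C \<in> graph_components g" and e: "e \<in> edges g" "e \<inter> C \<noteq> {}"
  shows "e \<subseteq> C"
proof -
  obtain u v where uv: "e = {u, v}" "adj g u v" using edgeE[OF g e(1)] by metis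
  then show ?thesis
    using e(2) graph_components_closed[OF g C, of u v] graph_components_closed[OF g C, of v u]
      adj_sym[of g u v] by auto
qed

text \<open>The sets \<open>U\<close> without boundary edges are the unions of components, so that the sum over \<open>U\<close>
  factorizes over the components.\<close>

lemma sum_over_unions_of_components:
  fixes y p :: real
  assumes g: "finite_simple_graph g"
  shows "(\<Sum>U\<in>Pow (verts g). y ^ card U * (\<Prod>e\<in>edges g. side_weight p U e))
    = (\<Prod>C\<in>graph_components g. 1 + y ^ card C * p ^ card {e \<in> edges g. e \<subseteq> C})"
proof -
  let ?K = "graph_components g"
  let ?f = "\<lambda>U. y ^ card U * (\<Prod>e\<in>edges g. side_weight p U e)"
  let ?b = "\<lambda>C. y ^ card C * p ^ card {e \<in> edges g. e \<subseteq> C}"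
  have sg: "simple_graph g" and fv: "finite (verts g)" using g by (auto simp: finite_simple_graph_def)
  note fE = finite_edges[OF g]
  have fK: "finite ?K" using finite_graph_components[OF fv] .
  have fC: "finite C" if "C \<in> ?K" for C using graph_components_subset[OF that] fv finite_subset by auto
  have ene: "e \<noteq> {}" if "e \<in> edges g" for e using edgeE[OF sg that] by blast
  have closed: "e \<subseteq> \<Union>S \<or> e \<inter> \<Union>S = {}" if "S \<subseteq> ?K" "e \<in> edges g" for S e
    using edge_in_component[OF sg _ that(2)] that(1) by blast
  have inj: "inj_on Union (Pow ?K)"
  proof (rule inj_onI)
    have *: "S \<subseteq> T" if ST: "S \<in> Pow ?K" "T \<in> Pow ?K" "\<Union>S = \<Union>T" for S T
    proof
      fix C assume C: "C \<in> S"
      then obtain x where x: "x \<in> C" using graph_components_nonempty[of C g] ST(1) by blast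
      then obtain C' where "C' \<in> T" "x \<in> C'" using C ST(3) by blast
      then show "C \<in> T" using graph_components_disjoint[of C g C'] x C ST(1,2) by blast
    qed
    fix S T assume "S \<in> Pow ?K" "T \<in> Pow ?K" "\<Union>S = \<Union>T"
    then show "S = T" using * by (metis subset_antisym)
  qed
  have "(\<Sum>U\<in>Pow (verts g). ?f U) = (\<Sum>U\<in>Union ` Pow ?K. ?f U)"
  proof (rule sum.mono_neutral_right)
    show "Union ` Pow ?K \<subseteq> Pow (verts g)" using Union_graph_components[of g] by blast
    show "\<forall>U\<in>Pow (verts g) - Union ` Pow ?K. ?f U = 0"
    proof
      fix U assume U: "U \<in> Pow (verts g) - Union ` Pow ?K"
      have "\<exists>e\<in>edges g. \<not> (e \<subseteq> U \<or> e \<inter> U = {})"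
      proof (rule ccontr)
        assume "\<not> ?thesis"
        then have "\<Union>{C \<in> ?K. C \<subseteq> U} = U" using U by (intro union_of_components[OF sg]) auto
        then have "U \<in> Union ` Pow ?K" by (intro image_eqI[of _ _ "{C \<in> ?K. C \<subseteq> U}"]) auto
        then show False using U by blast
      qed
      then have "(\<Prod>e\<in>edges g. side_weight p U e) = 0"
        using fE by (intro prod_zero) (auto simp: side_weight_def)
      then show "?f U = 0" by simp
    qed
  qed (use fv in simp)
  also have "\<dots> = (\<Sum>S\<in>Pow ?K. ?f (\<Union>S))" using inj by (simp add: sum.reindex)
  also have "\<dots> = (\<Sum>S\<in>Pow ?K. \<Prod>C\<in>S. ?b C)"
  proof (rule sum.cong[OF refl])
    fix S assume S: "S \<in> Pow ?K"
    have fS: "finite S" using S fK finite_subset by auto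
    have disj: "C \<inter> C' = {}" if "C \<in> S" "C' \<in> S" "C \<noteq> C'" for C C'
      using graph_components_disjoint that S by blast
    have c1: "card (\<Union>S) = (\<Sum>C\<in>S. card C)"
      using disj fC S by (subst card_Union_disjoint) (auto simp: pairwise_def disjnt_def)
    have "(\<Prod>e\<in>edges g. side_weight p (\<Union>S) e) = (\<Prod>e\<in>edges g. if e \<subseteq> \<Union>S then p else 1)"
      using closed[of S] S by (intro prod.cong) (auto simp: side_weight_def)
    also have "\<dots> = p ^ card {e \<in> edges g. e \<subseteq> \<Union>S}"
      using fE by (simp flip: prod.inter_filter)
    also have "{e \<in> edges g. e \<subseteq> \<Union>S} = (\<Union>C\<in>S. {e \<in> edges g. e \<subseteq> C})"
    proof
      show "{e \<in> edges g. e \<subseteq> \<Union>S} \<subseteq> (\<Union>C\<in>S. {e \<in> edges g. e \<subseteq> C})"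
      proof
        fix e assume e: "e \<in> {e \<in> edges g. e \<subseteq> \<Union>S}"
        then obtain C where C: "C \<in> S" "e \<inter> C \<noteq> {}" using ene by blast
        then have "e \<subseteq> C" using edge_in_component[OF sg, of C e] e S by blast
        then show "e \<in> (\<Union>C\<in>S. {e \<in> edges g. e \<subseteq> C})" using e C by blast
      qed
    qed auto
    also have "card \<dots> = (\<Sum>C\<in>S. card {e \<in> edges g. e \<subseteq> C})"
    proof (rule card_UN_disjoint[OF fS])
      show "\<forall>C\<in>S. finite {e \<in> edges g. e \<subseteq> C}" using fE by simp
      show "\<forall>C\<in>S. \<forall>C'\<in>S. C \<noteq> C' \<longrightarrow> {e \<in> edges g. e \<subseteq> C} \<inter> {e \<in> edges g. e \<subseteq> C'} = {}"
      proof (intro ballI impI)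
        fix C C' assume "C \<in> S" "C' \<in> S" "C \<noteq> C'"
        then have disj': "C \<inter> C' = {}" by (rule disj)
        have False if e: "e \<in> edges g" "e \<subseteq> C" "e \<subseteq> C'" for e
        proof -
          have "e \<subseteq> C \<inter> C'" using e by (intro Int_greatest)
          then show False using disj' ene[OF e(1)] by simp
        qed
        then show "{e \<in> edges g. e \<subseteq> C} \<inter> {e \<in> edges g. e \<subseteq> C'} = {}" by auto
      qed
    qed
    finally show "?f (\<Union>S) = (\<Prod>C\<in>S. ?b C)" by (simp add: c1 power_sum prod.distrib)
  qed
  also have "\<dots> = (\<Prod>C\<in>?K. ?b C + 1)" by (simp add: prod_add[OF fK])
  finally show ?thesis by (simp add: add.commute)
qed

text \<open>Exchanging the sums over \<open>U\<close> and over the set of open edges turns the partition function into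
  a sum over two-colourings, in which the edges contribute independent factors.\<close>

lemma Z_rank2_eq_sum_over_sets:
  assumes g: "finite_simple_graph g"
  shows "Z_rank2 g q w B = (\<Sum>U\<in>Pow (verts g). ((q - 1) * exp (- B)) ^ card U *
    (\<Prod>e\<in>edges g. 1 + w * side_weight (1 / (q - 1)) U e))"
proof -
  let ?y = "(q - 1) * exp (- B)" and ?t = "side_weight (1 / (q - 1))"
  have "Z_rank2 g q w B = (\<Sum>F\<in>Pow (edges g). w ^ card F *
      (\<Sum>U\<in>Pow (verts g). ?y ^ card U * (\<Prod>e\<in>F. ?t U e)))"
    unfolding Z_rank2_def
  proof (rule sum.cong[OF refl])
    fix F assume "F \<in> Pow (edges g)"
    then have "finite_simple_graph (UGraph (verts g) F)"
      using g unfolding finite_simple_graph_def simple_graph_def by auto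
    from sum_over_unions_of_components[OF this, of ?y "1 / (q - 1)"]
    show "w ^ card F * (\<Prod>C\<in>graph_components (UGraph (verts g) F).
          1 + euler_weight q B (UGraph (verts g) F) C)
        = w ^ card F * (\<Sum>U\<in>Pow (verts g). ?y ^ card U * (\<Prod>e\<in>F. ?t U e))"
      by (simp add: euler_weight_def)
  qed
  also have "\<dots> = (\<Sum>U\<in>Pow (verts g). \<Sum>F\<in>Pow (edges g). ?y ^ card U * (\<Prod>e\<in>F. w * ?t U e))"
    by (subst sum.swap) (simp add: sum_distrib_left prod.distrib mult_ac)
  also have "\<dots> = (\<Sum>U\<in>Pow (verts g). ?y ^ card U * (\<Prod>e\<in>edges g. w * ?t U e + 1))"
    by (simp add: prod_add[OF finite_edges[OF g]] sum_distrib_left)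
  finally show ?thesis by (simp add: add.commute)
qed

lemma sum_degree_weighted:
  fixes s :: "'v \<Rightarrow> real"
  assumes g: "finite_simple_graph g"
  shows "(\<Sum>v\<in>verts g. real (vdegree g v) * s v) = (\<Sum>e\<in>edges g. \<Sum>v\<in>e. s v)"
proof -
  have fv: "finite (verts g)" using g by (auto simp: finite_simple_graph_def)
  have "(\<Sum>v\<in>verts g. real (vdegree g v) * s v) = (\<Sum>v\<in>verts g. \<Sum>e\<in>{e \<in> edges g. v \<in> e}. s v)"
    by (simp add: vdegree_def incident_edges_def)
  also have "\<dots> = (\<Sum>e\<in>edges g. \<Sum>v\<in>{v \<in> verts g. v \<in> e}. s v)"
    by (rule sum.swap_restrict[OF fv finite_edges[OF g]])
  also have "\<dots> = (\<Sum>e\<in>edges g. \<Sum>v\<in>e. s v)"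
  proof (rule sum.cong[OF refl])
    fix e assume "e \<in> edges g"
    then have "e \<subseteq> verts g" using g by (auto simp: finite_simple_graph_def simple_graph_def)
    then have "{v \<in> verts g. v \<in> e} = e" by auto
    then show "(\<Sum>v\<in>{v \<in> verts g. v \<in> e}. s v) = (\<Sum>v\<in>e. s v)" by simp
  qed
  finally show ?thesis .
qed

text \<open>Let \<open>\<sigma>\<close> be \<open>- 1\<close> on \<open>U\<close> and 1 elsewhere. The constants \<open>\<beta>\<close> and \<open>k\<close> are such that
  \<open>exp (\<beta> + \<beta> * \<sigma> u * \<sigma> v + k * (\<sigma> u + \<sigma> v))\<close> is the factor of the edge \<open>{u, v}\<close>, and \<open>h\<close> accounts for
  the factor \<open>(q - 1) * exp (- B)\<close> of the vertices of \<open>U\<close>.\<close>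

lemma Z_rank2_eq_Z_eIsing:
  fixes g :: "'v ugraph"
  assumes g: "finite_simple_graph g" and q: "q \<ge> 2" and w: "w \<ge> 0"
    and k: "k = 1 / 4 * ln ((1 + w) / (1 + w / (q - 1)))"
    and \<beta>: "\<beta> = 1 / 4 * ln ((1 + w) * (1 + w / (q - 1)))"
    and h: "h = 1 / 2 * ln (exp B / (q - 1))"
  shows "Z_rank2 g q w B =
    exp (\<beta> * real (card (edges g)) + real (card (verts g)) * (1 / 2 * ln (exp (- B) * (q - 1))))
      * Z_eIsing g \<beta> k h"
proof -
  let ?y = "(q - 1) * exp (- B)" and ?t = "side_weight (1 / (q - 1))"
  define c where "c = 1 / 2 * ln (exp (- B) * (q - 1))"
  define s where "s U v = (if v \<in> U then - 1 else 1 :: real)" for U and v :: 'v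
  have sg: "simple_graph g" and fv: "finite (verts g)" using g by (auto simp: finite_simple_graph_def)
  note fE = finite_edges[OF g]
  have "ln (exp (- B) * (q - 1)) = - B + ln (q - 1)" "ln (exp B / (q - 1)) = B - ln (q - 1)"
    using q by (simp_all add: ln_mult ln_div)
  then have hc: "h = - c" unfolding h c_def by linarith
  have c2: "exp (2 * c) = ?y" unfolding c_def using q by (simp add: mult.commute)
  have w': "1 + w > 0" "1 + w / (q - 1) > 0" using w q by (auto intro: add_pos_nonneg)
  have bk: "exp (2 * \<beta> + 2 * k) = 1 + w" "exp (2 * \<beta> - 2 * k) = 1 + w / (q - 1)"
  proof -
    have "ln ((1 + w) * (1 + w / (q - 1))) = ln (1 + w) + ln (1 + w / (q - 1))"
      "ln ((1 + w) / (1 + w / (q - 1))) = ln (1 + w) - ln (1 + w / (q - 1))"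
      using w' by (auto simp: ln_mult ln_div)
    then have "2 * \<beta> + 2 * k = ln (1 + w)" "2 * \<beta> - 2 * k = ln (1 + w / (q - 1))"
      unfolding k \<beta> by linarith+
    then show "exp (2 * \<beta> + 2 * k) = 1 + w" "exp (2 * \<beta> - 2 * k) = 1 + w / (q - 1)"
      using w' by simp_all
  qed
  have edge: "1 + w * ?t U e = exp (\<beta> + \<beta> * (\<Prod>v\<in>e. s U v) + k * (\<Sum>v\<in>e. s U v))"
    if "e \<in> edges g" for U e
  proof -
    obtain u v where "e = {u, v}" "u \<noteq> v" using edgeE[OF sg \<open>e \<in> edges g\<close>] by metis
    then show ?thesis using bk by (auto simp: side_weight_def s_def algebra_simps)
  qed
  have vert: "?y ^ card U = exp (\<Sum>v\<in>verts g. c + h * s U v)" if "U \<subseteq> verts g" for U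
  proof -
    have "(\<Sum>v\<in>verts g. c + h * s U v) = (\<Sum>v\<in>verts g. if v \<in> U then 2 * c else 0)"
      by (intro sum.cong) (auto simp: hc s_def)
    also have "\<dots> = real (card U) * (2 * c)"
      using fv that by (simp add: sum.If_cases Int_absorb1)
    finally show ?thesis using c2 by (simp add: exp_of_nat_mult)
  qed
  have "Z_eIsing g \<beta> k h = (\<Sum>U\<in>Pow (verts g). exp (\<beta> * (\<Sum>e\<in>edges g. \<Prod>v\<in>e. s U v)
             + (\<Sum>v\<in>verts g. (k * real (vdegree g v) + h) * s U v)))"
    unfolding Z_eIsing_def insert_commute[of "-1" 1]
  proof (subst sum_PiE_two_values[OF fv], simp, rule sum.cong[OF refl])
    fix U
    let ?\<sigma> = "\<lambda>v\<in>verts g. if v \<in> U then - 1 else 1 :: real"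
    have "(\<Prod>v\<in>e. ?\<sigma> v) = (\<Prod>v\<in>e. s U v)" if "e \<in> edges g" for e
      using that sg by (intro prod.cong) (auto simp: s_def simple_graph_def)
    then have 1: "(\<Sum>e\<in>edges g. \<Prod>v\<in>e. ?\<sigma> v) = (\<Sum>e\<in>edges g. \<Prod>v\<in>e. s U v)" by simp
    have 2: "(\<Sum>v\<in>verts g. (k * real (vdegree g v) + h) * ?\<sigma> v)
      = (\<Sum>v\<in>verts g. (k * real (vdegree g v) + h) * s U v)"
      by (intro sum.cong) (auto simp: s_def)
    show "exp (\<beta> * (\<Sum>e\<in>edges g. \<Prod>v\<in>e. ?\<sigma> v) + (\<Sum>v\<in>verts g. (k * real (vdegree g v) + h) * ?\<sigma> v))
      = exp (\<beta> * (\<Sum>e\<in>edges g. \<Prod>v\<in>e. s U v) + (\<Sum>v\<in>verts g. (k * real (vdegree g v) + h) * s U v))"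
      unfolding 1 2 ..
  qed
  then have "exp (\<beta> * real (card (edges g)) + real (card (verts g)) * c) * Z_eIsing g \<beta> k h =
      (\<Sum>U\<in>Pow (verts g). exp (\<beta> * real (card (edges g)) + real (card (verts g)) * c) *
        exp (\<beta> * (\<Sum>e\<in>edges g. \<Prod>v\<in>e. s U v)
             + (\<Sum>v\<in>verts g. (k * real (vdegree g v) + h) * s U v)))"
    by (simp add: sum_distrib_left)
  also have "\<dots> = (\<Sum>U\<in>Pow (verts g). ?y ^ card U * (\<Prod>e\<in>edges g. 1 + w * ?t U e))"
  proof (rule sum.cong[OF refl])
    fix U assume U: "U \<in> Pow (verts g)"
    have "(\<Prod>e\<in>edges g. 1 + w * ?t U e)
        = exp (\<Sum>e\<in>edges g. \<beta> + \<beta> * (\<Prod>v\<in>e. s U v) + k * (\<Sum>v\<in>e. s U v))"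
      using fE edge by (simp add: exp_sum)
    also have "\<dots> = exp (\<beta> * real (card (edges g)) + \<beta> * (\<Sum>e\<in>edges g. \<Prod>v\<in>e. s U v)
        + k * (\<Sum>v\<in>verts g. real (vdegree g v) * s U v))"
      unfolding sum_degree_weighted[OF g] by (simp add: sum.distrib sum_distrib_left)
    finally have "?y ^ card U * (\<Prod>e\<in>edges g. 1 + w * ?t U e) =
       exp ((\<Sum>v\<in>verts g. c + h * s U v) + (\<beta> * real (card (edges g)) + \<beta> * (\<Sum>e\<in>edges g. \<Prod>v\<in>e. s U v)
        + k * (\<Sum>v\<in>verts g. real (vdegree g v) * s U v)))"
      using vert[of U] U by (simp add: exp_add)
    also have "\<dots> = exp (\<beta> * real (card (edges g)) + real (card (verts g)) * c) *
        exp (\<beta> * (\<Sum>e\<in>edges g. \<Prod>v\<in>e. s U v)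
             + (\<Sum>v\<in>verts g. (k * real (vdegree g v) + h) * s U v))"
      unfolding exp_add[symmetric] by (simp add: sum.distrib sum_distrib_left algebra_simps)
    finally show "exp (\<beta> * real (card (edges g)) + real (card (verts g)) * c) *
        exp (\<beta> * (\<Sum>e\<in>edges g. \<Prod>v\<in>e. s U v)
             + (\<Sum>v\<in>verts g. (k * real (vdegree g v) + h) * s U v)) =
        ?y ^ card U * (\<Prod>e\<in>edges g. 1 + w * ?t U e)" ..
  qed
  finally show ?thesis unfolding Z_rank2_eq_sum_over_sets[OF g] c_def by simp
qed

lemma ln_Z_rc_approx:
  assumes g: "finite_simple_graph g" and q: "q \<ge> 2" and w: "w \<ge> 0" and B: "B \<ge> 0" and r: "r \<ge> 1"
    and k: "k = 1 / 4 * ln ((1 + w) / (1 + w / (q - 1)))"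
    and \<beta>: "\<beta> = 1 / 4 * ln ((1 + w) * (1 + w / (q - 1)))"
    and h: "h = 1 / 2 * ln (exp B / (q - 1))"
  shows "\<bar>ln (Z_rc g q w B) - (\<beta> * real (card (edges g))
      + real (card (verts g)) * (1 / 2 * ln (exp (- B) * (q - 1))) + ln (Z_eIsing g \<beta> k h))\<bar>
    \<le> ln q * (real (card (verts g)) / real r + real (card (cyclic_nbhd_verts g r)))"
proof -
  let ?N = "real (card (verts g)) / real r + real (card (cyclic_nbhd_verts g r))"
  note pos = Z_rank2_pos[OF g q w, of B]
  note eq = Z_rank2_eq_Z_eIsing[OF g q w k \<beta> h]
  note le = Z_rc_bounds[OF g q w B r]
  have "Z_eIsing g \<beta> k h > 0" using pos unfolding eq by (simp add: zero_less_mult_iff)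
  then have ln: "ln (Z_rank2 g q w B) = \<beta> * real (card (edges g))
      + real (card (verts g)) * (1 / 2 * ln (exp (- B) * (q - 1))) + ln (Z_eIsing g \<beta> k h)"
    unfolding eq by (simp add: ln_mult)
  have "ln (Z_rank2 g q w B) \<le> ln (Z_rc g q w B)" using le(1) pos by simp
  moreover have "ln (Z_rc g q w B) \<le> ln (q powr ?N * Z_rank2 g q w B)"
    using le pos by (subst ln_le_cancel_iff) (auto intro: less_le_trans)
  moreover have "ln (q powr ?N * Z_rank2 g q w B) = ?N * ln q + ln (Z_rank2 g q w B)"
    using q pos by (simp add: ln_mult ln_powr)
  ultimately show ?thesis unfolding ln[symmetric] by (simp add: mult.commute)
qed

section \<open>Convergence in probability\<close>

lemma tendsto_in_prob_squeeze:
  assumes "prob_space M"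
    and approx: "\<And>\<epsilon>. \<epsilon> > 0 \<Longrightarrow> \<exists>R K. K \<ge> 0 \<and> tendsto_in_prob M R (\<lambda>_. 0)
      \<and> (\<forall>n\<ge>1. R n \<in> borel_measurable M)
      \<and> (\<forall>n\<ge>1. \<forall>\<omega>\<in>space M. \<bar>X n \<omega> - Y \<omega>\<bar> \<le> K * R n \<omega> + \<epsilon>)"
  shows "tendsto_in_prob M X Y"
  unfolding tendsto_in_prob_def
proof (intro allI impI)
  interpret prob_space M by fact
  fix \<epsilon> :: real assume \<epsilon>: "\<epsilon> > 0"
  obtain R K where K: "K \<ge> 0" and R: "tendsto_in_prob M R (\<lambda>_. 0)"
    and meas: "\<And>n. n \<ge> 1 \<Longrightarrow> R n \<in> borel_measurable M"
    and le: "\<And>n \<omega>. n \<ge> 1 \<Longrightarrow> \<omega> \<in> space M \<Longrightarrow> \<bar>X n \<omega> - Y \<omega>\<bar> \<le> K * R n \<omega> + \<epsilon> / 2"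
    using approx[of "\<epsilon> / 2"] \<epsilon> by auto
  define \<eta> where "\<eta> = \<epsilon> / (2 * (K + 1))"
  have \<eta>: "\<eta> > 0" using \<epsilon> K by (simp add: \<eta>_def)
  have K\<eta>: "K * \<eta> \<le> \<epsilon> / 2"
  proof -
    have "K + 1 \<noteq> 0" using K by simp
    have "K * \<eta> \<le> (K + 1) * \<eta>" using \<eta> by (simp add: algebra_simps)
    also have "\<dots> = \<epsilon> / 2" 
      using nonzero_mult_divide_mult_cancel_left[OF \<open>K + 1 \<noteq> 0\<close>, of \<epsilon> 2] by (simp add: \<eta>_def mult_ac)
    finally show ?thesis .
  qed
  show "(\<lambda>n. measure M {\<omega> \<in> space M. \<bar>X n \<omega> - Y \<omega>\<bar> > \<epsilon>}) \<longlonglongrightarrow> 0"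
  proof (rule tendsto_sandwich[OF _ _ tendsto_const])
    show "(\<lambda>n. measure M {\<omega> \<in> space M. \<bar>R n \<omega> - 0\<bar> > \<eta>}) \<longlonglongrightarrow> 0"
      using R \<eta> unfolding tendsto_in_prob_def by blast
    show "\<forall>\<^sub>F n in sequentially. measure M {\<omega> \<in> space M. \<bar>X n \<omega> - Y \<omega>\<bar> > \<epsilon>}
        \<le> measure M {\<omega> \<in> space M. \<bar>R n \<omega> - 0\<bar> > \<eta>}"
    proof (rule eventually_sequentiallyI[of 1])
      fix n :: nat assume n: "1 \<le> n"
      note [measurable] = meas[OF n]
      show "measure M {\<omega> \<in> space M. \<bar>X n \<omega> - Y \<omega>\<bar> > \<epsilon>} \<le> measure M {\<omega> \<in> space M. \<bar>R n \<omega> - 0\<bar> > \<eta>}"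
      proof (rule finite_measure_mono)
        show "{\<omega> \<in> space M. \<bar>X n \<omega> - Y \<omega>\<bar> > \<epsilon>} \<subseteq> {\<omega> \<in> space M. \<bar>R n \<omega> - 0\<bar> > \<eta>}"
        proof (clarify, rule ccontr)
          fix \<omega> assume \<omega>: "\<omega> \<in> space M" "\<bar>X n \<omega> - Y \<omega>\<bar> > \<epsilon>" "\<not> \<bar>R n \<omega> - 0\<bar> > \<eta>"
          have "K * R n \<omega> \<le> K * \<eta>" using \<omega>(3) K by (intro mult_left_mono) auto
          then show False using le[OF n \<omega>(1)] \<omega>(2) K\<eta> by linarith
        qed
      qed measurable
    qed
  qed simp
qed

lemma tendsto_in_prob_cong:
  assumes "tendsto_in_prob M X Y" "\<And>n \<omega>. n \<ge> 1 \<Longrightarrow> \<omega> \<in> space M \<Longrightarrow> X n \<omega> = X' n \<omega>"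
  shows "tendsto_in_prob M X' Y"
  unfolding tendsto_in_prob_def
proof (intro allI impI)
  fix \<epsilon> :: real assume \<epsilon>: "\<epsilon> > 0"
  have "(\<lambda>n. measure M {\<omega> \<in> space M. \<bar>X n \<omega> - Y \<omega>\<bar> > \<epsilon>}) \<longlonglongrightarrow> 0"
    using assms(1) \<epsilon> unfolding tendsto_in_prob_def by blast
  moreover have "\<forall>\<^sub>F n in sequentially. measure M {\<omega> \<in> space M. \<bar>X n \<omega> - Y \<omega>\<bar> > \<epsilon>}
      = measure M {\<omega> \<in> space M. \<bar>X' n \<omega> - Y \<omega>\<bar> > \<epsilon>}"
    using assms(2) by (intro eventually_sequentiallyI[of 1] arg_cong[where f = "measure M"]) auto
  ultimately show "(\<lambda>n. measure M {\<omega> \<in> space M. \<bar>X' n \<omega> - Y \<omega>\<bar> > \<epsilon>}) \<longlonglongrightarrow> 0"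
    by (rule Lim_transform_eventually)
qed

lemma tendsto_in_prob_sum_abs_diff:
  fixes A :: "'i \<Rightarrow> nat \<Rightarrow> 'w \<Rightarrow> real"
  assumes "prob_space M" and fin: "finite I"
    and lim: "\<And>i. i \<in> I \<Longrightarrow> tendsto_in_prob M (A i) (a i)"
    and meas: "\<And>i n. i \<in> I \<Longrightarrow> n \<ge> 1 \<Longrightarrow> A i n \<in> borel_measurable M"
    and meas': "\<And>i. i \<in> I \<Longrightarrow> a i \<in> borel_measurable M"
  shows "tendsto_in_prob M (\<lambda>n \<omega>. \<Sum>i\<in>I. \<bar>A i n \<omega> - a i \<omega>\<bar>) (\<lambda>_. 0)"
  unfolding tendsto_in_prob_def
proof (intro allI impI)
  interpret prob_space M by fact
  fix \<epsilon> :: real assume \<epsilon>: "\<epsilon> > 0"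
  define \<eta> where "\<eta> = \<epsilon> / (card I + 1)"
  have \<eta>: "\<eta> > 0" using \<epsilon> by (simp add: \<eta>_def)
  let ?S = "\<lambda>i n. {\<omega> \<in> space M. \<bar>A i n \<omega> - a i \<omega>\<bar> > \<eta>}"
  show "(\<lambda>n. measure M {\<omega> \<in> space M. \<bar>(\<Sum>i\<in>I. \<bar>A i n \<omega> - a i \<omega>\<bar>) - 0\<bar> > \<epsilon>}) \<longlonglongrightarrow> 0"
  proof (rule tendsto_sandwich[OF _ _ tendsto_const])
    show "(\<lambda>n. \<Sum>i\<in>I. measure M (?S i n)) \<longlonglongrightarrow> 0"
      using lim \<eta> unfolding tendsto_in_prob_def by (intro tendsto_null_sum) blast
    show "\<forall>\<^sub>F n in sequentially.
      measure M {\<omega> \<in> space M. \<bar>(\<Sum>i\<in>I. \<bar>A i n \<omega> - a i \<omega>\<bar>) - 0\<bar> > \<epsilon>} \<le> (\<Sum>i\<in>I. measure M (?S i n))"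
    proof (rule eventually_sequentiallyI[of 1])
      fix n :: nat assume n: "1 \<le> n"
      have S: "?S i n \<in> sets M" if "i \<in> I" for i
        using meas[OF that n] meas'[OF that] by measurable
      have "measure M {\<omega> \<in> space M. \<bar>(\<Sum>i\<in>I. \<bar>A i n \<omega> - a i \<omega>\<bar>) - 0\<bar> > \<epsilon>}
          \<le> measure M (\<Union>i\<in>I. ?S i n)"
      proof (rule finite_measure_mono)
        show "{\<omega> \<in> space M. \<bar>(\<Sum>i\<in>I. \<bar>A i n \<omega> - a i \<omega>\<bar>) - 0\<bar> > \<epsilon>} \<subseteq> (\<Union>i\<in>I. ?S i n)"
        proof (clarify, rule ccontr)
          fix \<omega> assume \<omega>: "\<omega> \<in> space M" "\<bar>(\<Sum>i\<in>I. \<bar>A i n \<omega> - a i \<omega>\<bar>) - 0\<bar> > \<epsilon>"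
            "\<omega> \<notin> (\<Union>i\<in>I. ?S i n)"
          have "(\<Sum>i\<in>I. \<bar>A i n \<omega> - a i \<omega>\<bar>) \<le> (\<Sum>i\<in>I. \<eta>)" using \<omega> by (intro sum_mono) force
          also have "\<dots> \<le> \<epsilon>" using \<epsilon> by (simp add: \<eta>_def field_simps)
          finally show False using \<omega>(2) by (simp add: sum_nonneg)
        qed
        show "(\<Union>i\<in>I. ?S i n) \<in> sets M" using S fin by blast
      qed
      also have "\<dots> \<le> (\<Sum>i\<in>I. measure M (?S i n))"
        using S fin by (intro finite_measure_subadditive_finite) auto
      finally show "measure M {\<omega> \<in> space M. \<bar>(\<Sum>i\<in>I. \<bar>A i n \<omega> - a i \<omega>\<bar>) - 0\<bar> > \<epsilon>}
        \<le> (\<Sum>i\<in>I. measure M (?S i n))" .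
    qed
  qed simp
qed

lemma integral_tendsto_of_tendsto_in_prob:
  assumes "prob_space M"
    and lim: "tendsto_in_prob M X (\<lambda>_. c)"
    and meas: "\<And>n. n \<ge> 1 \<Longrightarrow> X n \<in> borel_measurable M"
    and bdd: "\<And>n \<omega>. n \<ge> 1 \<Longrightarrow> \<omega> \<in> space M \<Longrightarrow> \<bar>X n \<omega>\<bar> \<le> K"
  shows "(\<lambda>n. \<integral>\<omega>. X n \<omega> \<partial>M) \<longlonglongrightarrow> c"
proof (rule tendstoI)
  interpret prob_space M by fact
  fix \<epsilon> :: real assume \<epsilon>: "\<epsilon> > 0"
  define B where "B = \<bar>K\<bar> + \<bar>c\<bar> + 1"
  have B: "B > 0" by (simp add: B_def)
  let ?S = "\<lambda>n. {\<omega> \<in> space M. \<bar>X n \<omega> - c\<bar> > \<epsilon> / 2}"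
  have "(\<lambda>n. measure M (?S n)) \<longlonglongrightarrow> 0"
    using lim \<epsilon> unfolding tendsto_in_prob_def by (meson half_gt_zero)
  then have "\<forall>\<^sub>F n in sequentially. measure M (?S n) < \<epsilon> / (2 * B)"
    using \<epsilon> B by (intro order_tendstoD(2)) auto
  then show "\<forall>\<^sub>F n in sequentially. dist (\<integral>\<omega>. X n \<omega> \<partial>M) c < \<epsilon>"
    using eventually_ge_at_top[of 1]
  proof eventually_elim
    case (elim n)
    note [measurable] = meas[OF elim(2)]
    have S[measurable]: "?S n \<in> sets M" by measurable
    have int: "integrable M (X n)"
      using bdd[OF elim(2)] by (intro integrable_const_bound[of _ K]) auto
    have "(\<integral>\<omega>. X n \<omega> \<partial>M) - c = (\<integral>\<omega>. X n \<omega> - c \<partial>M)"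
      using int by (simp add: prob_space)
    also have "\<bar>\<dots>\<bar> \<le> (\<integral>\<omega>. \<bar>X n \<omega> - c\<bar> \<partial>M)" by (rule integral_abs_bound)
    also have "\<dots> \<le> (\<integral>\<omega>. \<epsilon> / 2 + B * indicator (?S n) \<omega> \<partial>M)"
    proof (rule integral_mono)
      fix \<omega> assume \<omega>: "\<omega> \<in> space M"
      have "\<bar>X n \<omega> - c\<bar> \<le> B" using bdd[OF elim(2) \<omega>] unfolding B_def by linarith
      then show "\<bar>X n \<omega> - c\<bar> \<le> \<epsilon> / 2 + B * indicator (?S n) \<omega>"
        using \<epsilon> \<omega> by (auto simp: indicator_def)
    qed (use int in \<open>auto intro!: integrable_real_indicator simp: emeasure_eq_measure\<close>)
    also have "\<dots> = \<epsilon> / 2 + B * measure M (?S n)"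
      by (simp add: prob_space emeasure_eq_measure)
    also have "\<dots> < \<epsilon>" using elim(1) B by (simp add: field_simps)
    finally show ?case by (simp add: dist_real_def)
  qed
qed

text \<open>The mean of a bounded function of a discrete random variable is determined by finitely many of
  the point probabilities, up to the remaining mass.\<close>

lemma (in prob_space) integral_discrete_truncation:
  fixes f :: "nat \<Rightarrow> real"
  assumes T[measurable]: "T \<in> M \<rightarrow>\<^sub>M count_space UNIV" and f: "\<And>i. 0 \<le> f i" "\<And>i. f i \<le> K"
  shows "\<bar>(\<integral>x. f (T x) \<partial>M) - (\<Sum>i<m. f i * prob {x \<in> space M. T x = i})\<bar>
    \<le> K * (1 - (\<Sum>i<m. prob {x \<in> space M. T x = i}))"
proof -
  let ?I = "\<lambda>i. indicator {x \<in> space M. T x = i} :: _ \<Rightarrow> real"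
  have int: "integrable M (\<lambda>x. f (T x))"
    using f by (intro integrable_const_bound[of _ K]) (auto simp: abs_of_nonneg)
  have intI: "integrable M (?I i)" for i
    by (intro integrable_real_indicator) (auto simp: emeasure_eq_measure)
  have int_sum: "integrable M (\<lambda>x. \<Sum>i<m. c i * ?I i x)" for c
    by (intro Bochner_Integration.integrable_sum integrable_mult_right intI)
  have sum_integral: "(\<integral>x. (\<Sum>i<m. c i * ?I i x) \<partial>M) = (\<Sum>i<m. c i * prob {x \<in> space M. T x = i})" for c
  proof -
    have "(\<integral>x. (\<Sum>i<m. c i * ?I i x) \<partial>M) = (\<Sum>i<m. \<integral>x. c i * ?I i x \<partial>M)"
      by (intro Bochner_Integration.integral_sum integrable_mult_right intI)
    also have "\<dots> = (\<Sum>i<m. c i * prob {x \<in> space M. T x = i})"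
    proof (rule sum.cong[OF refl])
      fix i
      have "{x \<in> space M. T x = i} \<in> events" by measurable
      then show "(\<integral>x. c i * ?I i x \<partial>M) = c i * prob {x \<in> space M. T x = i}" by simp
    qed
    finally show ?thesis .
  qed
  have sum_I: "(\<Sum>i<m. c i * ?I i x) = (if T x < m then c (T x) else 0)" if "x \<in> space M" for x c
  proof -
    have "(\<Sum>i<m. c i * ?I i x) = (\<Sum>i<m. if T x = i then c i else 0)"
      using that by (intro sum.cong) (auto simp: indicator_def)
    then show ?thesis by simp
  qed
  have "(\<integral>x. f (T x) \<partial>M) - (\<Sum>i<m. f i * prob {x \<in> space M. T x = i})
    = (\<integral>x. f (T x) - (\<Sum>i<m. f i * ?I i x) \<partial>M)"
    using int int_sum[of f] sum_integral[of f] by simp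
  also have "\<bar>\<dots>\<bar> \<le> (\<integral>x. \<bar>f (T x) - (\<Sum>i<m. f i * ?I i x)\<bar> \<partial>M)" by (rule integral_abs_bound)
  also have "\<dots> \<le> (\<integral>x. K * (1 - (\<Sum>i<m. 1 * ?I i x)) \<partial>M)"
  proof (rule integral_mono)
    fix x assume "x \<in> space M"
    then show "\<bar>f (T x) - (\<Sum>i<m. f i * ?I i x)\<bar> \<le> K * (1 - (\<Sum>i<m. 1 * ?I i x))"
      unfolding sum_I[OF \<open>x \<in> space M\<close>] using f by (auto simp: abs_of_nonneg)
  qed (intro integrable_abs Bochner_Integration.integrable_diff integrable_mult_right integrable_const
      int int_sum)+
  also have "\<dots> = K * (1 - (\<Sum>i<m. prob {x \<in> space M. T x = i}))"
  proof -
    have "(\<integral>x. 1 - (\<Sum>i<m. 1 * ?I i x) \<partial>M) = 1 - (\<Sum>i<m. 1 * prob {x \<in> space M. T x = i})"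
      unfolding sum_integral[symmetric]
      by (subst Bochner_Integration.integral_diff[OF integrable_const int_sum]) (simp add: prob_space)
    then show ?thesis by simp
  qed
  finally show ?thesis .
qed

section \<open>Rooted isomorphism types\<close>

lemma rooted_iso_sym:
  assumes "x \<in> verts g" "rooted_iso g x h y"
  shows "rooted_iso h y g x"
proof -
  obtain f where f: "bij_betw f (verts g) (verts h)" "f x = y"
    "\<And>u v. u \<in> verts g \<Longrightarrow> v \<in> verts g \<Longrightarrow> adj g u v \<longleftrightarrow> adj h (f u) (f v)"
    using assms(2) unfolding rooted_iso_def by blast
  let ?f = "the_inv_into (verts g) f"
  have inj: "inj_on f (verts g)" and im: "f ` verts g = verts h" using f(1) by (auto simp: bij_betw_def)
  have "bij_betw ?f (verts h) (verts g)" using f(1) by (rule bij_betw_the_inv_into)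
  moreover have "?f y = x" using the_inv_into_f_f[OF inj assms(1)] f(2) by simp
  moreover have "adj h u v \<longleftrightarrow> adj g (?f u) (?f v)" if "u \<in> verts h" "v \<in> verts h" for u v
    using f(3)[of "?f u" "?f v"] that inj im by (simp add: f_the_inv_into_f the_inv_into_into)
  ultimately show ?thesis unfolding rooted_iso_def by blast
qed

lemma rooted_iso_trans:
  assumes "rooted_iso g x h y" "rooted_iso h y k z"
  shows "rooted_iso g x k z"
proof -
  obtain f where f: "bij_betw f (verts g) (verts h)" "f x = y"
    "\<forall>u\<in>verts g. \<forall>v\<in>verts g. adj g u v \<longleftrightarrow> adj h (f u) (f v)"
    using assms(1) unfolding rooted_iso_def by blast
  obtain f' where f': "bij_betw f' (verts h) (verts k)" "f' y = z"
    "\<forall>u\<in>verts h. \<forall>v\<in>verts h. adj h u v \<longleftrightarrow> adj k (f' u) (f' v)"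
    using assms(2) unfolding rooted_iso_def by blast
  have "bij_betw (f' \<circ> f) (verts g) (verts k)" using f(1) f'(1) by (rule bij_betw_trans)
  moreover have "f u \<in> verts h" if "u \<in> verts g" for u using f(1) that by (auto simp: bij_betw_def)
  ultimately show ?thesis using f f' unfolding rooted_iso_def by (intro exI[of _ "f' \<circ> f"]) auto
qed

lemma exists_rooted_iso_nat:
  assumes g: "finite_simple_graph g" and x: "x \<in> verts g"
  shows "\<exists>(H::nat ugraph) z. finite_simple_graph H \<and> z \<in> verts H \<and> rooted_iso g x H z"
proof -
  have fv: "finite (verts g)" and sub: "\<And>e. e \<in> edges g \<Longrightarrow> e \<subseteq> verts g \<and> card e = 2"
    using g by (auto simp: finite_simple_graph_def simple_graph_def)
  obtain f where f: "bij_betw f (verts g) {0..<card (verts g)}"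
    using ex_bij_betw_finite_nat[OF fv] by blast
  have inj: "inj_on f (verts g)" using f by (auto simp: bij_betw_def)
  let ?H = "UGraph {0..<card (verts g)} ((`) f ` edges g)"
  have "finite_simple_graph ?H"
    unfolding finite_simple_graph_def simple_graph_def
  proof (intro conjI ballI)
    fix e assume "e \<in> edges ?H"
    then obtain e' where e': "e' \<in> edges g" "e = f ` e'" by auto
    show "e \<subseteq> verts ?H" using e' sub[OF e'(1)] f by (auto simp: bij_betw_def)
    show "card e = 2" using e' sub[OF e'(1)] card_image[OF inj_on_subset[OF inj]] by metis
  qed simp
  moreover have "adj g u v \<longleftrightarrow> adj ?H (f u) (f v)" if uv: "u \<in> verts g" "v \<in> verts g" for u v
  proof
    assume "adj ?H (f u) (f v)"
    then obtain e where e: "e \<in> edges g" "f ` {u, v} = f ` e" by (auto simp: adj_def)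
    then have "{u, v} = e" using inj_on_image_eq_iff[OF inj, of "{u, v}" e] uv sub by auto
    then show "adj g u v" using e by (simp add: adj_def)
  next
    assume "adj g u v"
    then have "f ` {u, v} \<in> (`) f ` edges g" unfolding adj_def by (rule imageI)
    then show "adj ?H (f u) (f v)" by (simp add: adj_def)
  qed
  then have "rooted_iso g x ?H (f x)" using f unfolding rooted_iso_def by (intro exI[of _ f]) auto
  moreover have "f x \<in> verts ?H" using f x by (auto simp: bij_betw_def)
  ultimately show ?thesis by blast
qed

text \<open>The finite rooted graphs with natural numbers as vertices, and an enumeration of this countable
  set; the enumeration may have repetitions.\<close>

definition nat_rooted_graphs :: "(nat ugraph \<times> nat) set" where
  "nat_rooted_graphs = {(H, z). finite_simple_graph H \<and> z \<in> verts H}"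

definition nat_rooted_graph :: "nat \<Rightarrow> nat ugraph \<times> nat" where
  "nat_rooted_graph = from_nat_into nat_rooted_graphs"

text \<open>The isomorphism type of a finite rooted graph, encoded as the least index of an isomorphic graph
  in the enumeration. It is an invariant that does not depend on the type of the vertices.\<close>

definition iso_type :: "'v ugraph \<Rightarrow> 'v \<Rightarrow> nat" where
  "iso_type g x = (LEAST i. rooted_iso g x (fst (nat_rooted_graph i)) (snd (nat_rooted_graph i)))"

lemma countable_nat_rooted_graphs: "countable nat_rooted_graphs"
proof -
  let ?S = "Collect finite :: nat set set"
  have S: "countable ?S" by (rule countable_Collect_finite)
  then have "countable {E. finite E \<and> E \<subseteq> ?S}" by (rule countable_Collect_finite_subset)
  then have c: "countable ((?S \<times> {E. finite E \<and> E \<subseteq> ?S}) \<times> (UNIV :: nat set))"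
    using S by (intro countable_SIGMA) auto
  show ?thesis
  proof (rule countable_subset[OF _ countable_image[OF c, of "\<lambda>((V, E), z). (UGraph V E, z)"]])
    show "nat_rooted_graphs \<subseteq> (\<lambda>((V, E), z). (UGraph V E, z)) `
        ((?S \<times> {E. finite E \<and> E \<subseteq> ?S}) \<times> UNIV)"
    proof (clarsimp simp: nat_rooted_graphs_def)
      fix H :: "nat ugraph" and z assume H: "finite_simple_graph H" "z \<in> verts H"
      have "finite (verts H)" "finite (edges H)" "edges H \<subseteq> ?S"
        using H finite_edges[OF H(1)] by (auto simp: finite_simple_graph_def simple_graph_def intro: finite_subset)
      then show "(H, z) \<in> (\<lambda>((V, E), z). (UGraph V E, z)) `
        ((?S \<times> {E. finite E \<and> E \<subseteq> ?S}) \<times> UNIV)"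
        by (intro image_eqI[of _ _ "((verts H, edges H), z)"]) auto
    qed
  qed
qed

lemma nat_rooted_graph_in:
  "finite_simple_graph (fst (nat_rooted_graph i))" "snd (nat_rooted_graph i) \<in> verts (fst (nat_rooted_graph i))"
proof -
  have "(UGraph {0} {}, 0) \<in> nat_rooted_graphs"
    by (simp add: nat_rooted_graphs_def finite_simple_graph_def simple_graph_def)
  then have "nat_rooted_graph i \<in> nat_rooted_graphs"
    unfolding nat_rooted_graph_def by (intro from_nat_into) blast
  then show "finite_simple_graph (fst (nat_rooted_graph i))"
    "snd (nat_rooted_graph i) \<in> verts (fst (nat_rooted_graph i))"
    by (auto simp: nat_rooted_graphs_def case_prod_unfold)
qed

lemma rooted_iso_iso_type:
  assumes "finite_simple_graph g" "x \<in> verts g"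
  shows "rooted_iso g x (fst (nat_rooted_graph (iso_type g x))) (snd (nat_rooted_graph (iso_type g x)))"
proof -
  obtain H :: "nat ugraph" and z where H: "finite_simple_graph H" "z \<in> verts H" "rooted_iso g x H z"
    using exists_rooted_iso_nat[OF assms] by blast
  then have "(H, z) \<in> nat_rooted_graphs" by (simp add: nat_rooted_graphs_def)
  then obtain i where "nat_rooted_graph i = (H, z)"
    unfolding nat_rooted_graph_def by (metis countable_nat_rooted_graphs from_nat_into_surj)
  then show ?thesis
    using LeastI[of "\<lambda>i. rooted_iso g x (fst (nat_rooted_graph i)) (snd (nat_rooted_graph i))" i] H(3)
    unfolding iso_type_def by simp
qed

lemma iso_type_cong:
  assumes "x \<in> verts g" "rooted_iso g x h y"
  shows "iso_type g x = iso_type h y"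
proof -
  have "rooted_iso g x H z \<longleftrightarrow> rooted_iso h y H z" for H :: "nat ugraph" and z
  proof
    show "rooted_iso h y H z" if "rooted_iso g x H z"
      using rooted_iso_sym[OF assms] that by (rule rooted_iso_trans)
    show "rooted_iso g x H z" if "rooted_iso h y H z"
      using assms(2) that by (rule rooted_iso_trans)
  qed
  then show ?thesis unfolding iso_type_def by simp
qed

text \<open>Only the indices that are least in their isomorphism class occur as types.\<close>

lemma iso_type_eq_iff:
  assumes "finite_simple_graph g" "x \<in> verts g"
  shows "iso_type g x = i \<longleftrightarrow>
    iso_type (fst (nat_rooted_graph i)) (snd (nat_rooted_graph i)) = i \<and>
    rooted_iso g x (fst (nat_rooted_graph i)) (snd (nat_rooted_graph i))"
proof
  assume i: "iso_type g x = i"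
  then have iso: "rooted_iso g x (fst (nat_rooted_graph i)) (snd (nat_rooted_graph i))"
    using rooted_iso_iso_type[OF assms] by blast
  then show "iso_type (fst (nat_rooted_graph i)) (snd (nat_rooted_graph i)) = i \<and>
    rooted_iso g x (fst (nat_rooted_graph i)) (snd (nat_rooted_graph i))"
    using iso_type_cong[OF assms(2) iso] i by simp
next
  assume i: "iso_type (fst (nat_rooted_graph i)) (snd (nat_rooted_graph i)) = i \<and>
    rooted_iso g x (fst (nat_rooted_graph i)) (snd (nat_rooted_graph i))"
  have "iso_type g x = iso_type (fst (nat_rooted_graph i)) (snd (nat_rooted_graph i))"
    by (rule iso_type_cong[OF assms(2) conjunct2[OF i]])
  then show "iso_type g x = i" using conjunct1[OF i] by (rule trans)
qed

section \<open>Neighbourhoods\<close>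

lemma finite_neighbours:
  assumes "finite (incident_edges g u)" "simple_graph g"
  shows "finite {v. adj g u v}"
proof (rule finite_subset)
  show "{v. adj g u v} \<subseteq> \<Union>(incident_edges g u)"
    by (auto simp: adj_def incident_edges_def)
  show "finite (\<Union>(incident_edges g u))"
  proof (rule finite_Union[OF assms(1)])
    fix e assume "e \<in> incident_edges g u"
    then have "card e = 2" using assms(2) by (auto simp: incident_edges_def simple_graph_def)
    then show "finite e" by (metis card.infinite zero_neq_numeral)
  qed
qed

lemma root_in_nbhd: "x \<in> verts g \<Longrightarrow> x \<in> verts (nbhd g x r)"
  by (auto simp: nbhd_def nbhd_verts_def intro: exI[of _ 0])

lemma simple_nbhd: "simple_graph g \<Longrightarrow> simple_graph (nbhd g x r)"
  by (auto simp: nbhd_def simple_graph_def)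

lemma finite_simple_nbhd:
  assumes g: "simple_graph g" and lf: "locally_finite_graph g"
  shows "finite_simple_graph (nbhd g x r)"
proof -
  have "finite (nbhd_verts g x r)"
  proof (induction r)
    case 0
    have "nbhd_verts g x 0 \<subseteq> {x}" by (auto simp: nbhd_verts_def)
    then show ?case using finite_subset by blast
  next
    case (Suc r)
    have "nbhd_verts g x (Suc r) \<subseteq> nbhd_verts g x r \<union> (\<Union>u\<in>nbhd_verts g x r. {v. adj g u v})"
    proof
      fix v assume "v \<in> nbhd_verts g x (Suc r)"
      then obtain k where k: "v \<in> verts g" "k \<le> Suc r" "(adj g ^^ k) x v" by (auto simp: nbhd_verts_def)
      show "v \<in> nbhd_verts g x r \<union> (\<Union>u\<in>nbhd_verts g x r. {v. adj g u v})"
      proof (cases "k = Suc r")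
        case True
        then obtain u where u: "(adj g ^^ r) x u" "adj g u v" using k(3) by auto
        then have "u \<in> nbhd_verts g x r" using adj_in_verts[OF g u(2)] by (auto simp: nbhd_verts_def)
        then show ?thesis using u(2) by blast
      next
        case False
        then have "k \<le> r" using k(2) by simp
        then show ?thesis using k by (auto simp: nbhd_verts_def)
      qed
    qed
    moreover have "finite {v. adj g u v}" if "u \<in> nbhd_verts g x r" for u
      using that lf by (intro finite_neighbours[OF _ g]) (auto simp: locally_finite_graph_def nbhd_verts_def)
    ultimately show ?case using Suc.IH by (meson finite_UN finite_Un finite_subset)
  qed
  then show ?thesis using simple_nbhd[OF g] by (simp add: finite_simple_graph_def nbhd_def)
qed

lemma locally_finite_of_finite: "finite_simple_graph g \<Longrightarrow> locally_finite_graph g"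
  using finite_edges[of g] by (simp add: locally_finite_graph_def incident_edges_def)

lemma vdegree_nbhd:
  assumes g: "simple_graph g" and x: "x \<in> verts g"
  shows "vdegree (nbhd g x 1) x = vdegree g x"
proof -
  have "adj (nbhd g x 1) x u \<longleftrightarrow> adj g x u" for u
  proof
    assume xu: "adj g x u"
    then have "u \<in> nbhd_verts g x 1" using adj_in_verts[OF g xu]
      by (auto simp: nbhd_verts_def intro!: exI[of _ 1])
    then show "adj (nbhd g x 1) x u" using xu root_in_nbhd[OF x, of 1] by (simp add: nbhd_def adj_def)
  qed (simp add: nbhd_def adj_def)
  then show ?thesis
    by (simp add: vdegree_eq_card_neighbours[OF g] vdegree_eq_card_neighbours[OF simple_nbhd[OF g]])
qed

lemma rooted_iso_vdegree:
  assumes "simple_graph g" "simple_graph h" "x \<in> verts g" "rooted_iso g x h y"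
  shows "vdegree g x = vdegree h y"
proof -
  obtain f where f: "bij_betw f (verts g) (verts h)" "f x = y"
    "\<And>u v. u \<in> verts g \<Longrightarrow> v \<in> verts g \<Longrightarrow> adj g u v \<longleftrightarrow> adj h (f u) (f v)"
    using assms(4) unfolding rooted_iso_def by blast
  have "bij_betw f {u. adj g x u} {u. adj h y u}"
    unfolding bij_betw_def
  proof
    have sub: "{u. adj g x u} \<subseteq> verts g" using adj_in_verts[OF assms(1)] by blast
    then show "inj_on f {u. adj g x u}" using f(1) inj_on_subset by (auto simp: bij_betw_def)
    show "f ` {u. adj g x u} = {u. adj h y u}"
    proof
      show "f ` {u. adj g x u} \<subseteq> {u. adj h y u}" using sub f(2,3) assms(3) by auto
      show "{u. adj h y u} \<subseteq> f ` {u. adj g x u}"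
      proof
        fix u assume u: "u \<in> {u. adj h y u}"
        then have "u \<in> verts h" using adj_in_verts[OF assms(2)] by blast
        then obtain u' where "u' \<in> verts g" "u = f u'" using f(1) by (auto simp: bij_betw_def)
        then show "u \<in> f ` {u. adj g x u}" using u f(2,3) assms(3) by auto
      qed
    qed
  qed
  then show ?thesis using vdegree_eq_card_neighbours assms(1,2) bij_betw_same_card by metis
qed

lemma cycle_verts: "simple_graph g \<Longrightarrow> is_cycle g vs \<Longrightarrow> set vs \<subseteq> verts g"
proof
  fix v assume g: "simple_graph g" and c: "is_cycle g vs" and v: "v \<in> set vs"
  have c': "length vs \<ge> 3" "successively (adj g) vs" using c by (auto simp: is_cycle_def)
  obtain i where i: "i < length vs" "v = vs ! i" using v by (metis in_set_conv_nth)
  show "v \<in> verts g"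
  proof (cases "Suc i < length vs")
    case True
    then have "adj g (vs ! i) (vs ! Suc i)" using c'(2) by (simp add: successively_conv_nth)
    then show ?thesis using i adj_in_verts[OF g] by blast
  next
    case False
    then have "Suc (i - 1) < length vs" "Suc (i - 1) = i" using i c'(1) by auto
    then have "adj g (vs ! (i - 1)) (vs ! i)" using c'(2) by (metis successively_conv_nth)
    then show ?thesis using i adj_in_verts[OF g] by blast
  qed
qed

lemma rooted_iso_cycle:
  assumes "simple_graph g" "x \<in> verts g" "rooted_iso g x h y" "is_cycle g vs"
  shows "\<exists>vs. is_cycle h vs"
proof -
  obtain f where f: "bij_betw f (verts g) (verts h)" "f x = y"
    "\<And>u v. u \<in> verts g \<Longrightarrow> v \<in> verts g \<Longrightarrow> adj g u v \<longleftrightarrow> adj h (f u) (f v)"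
    using assms(3) unfolding rooted_iso_def by blast
  have sub: "set vs \<subseteq> verts g" using cycle_verts assms by blast
  have ne: "vs \<noteq> []" using assms(4) by (auto simp: is_cycle_def)
  have "distinct (map f vs)"
    using assms(4) f(1) sub inj_on_subset by (auto simp: is_cycle_def distinct_map bij_betw_def)
  moreover have "successively (adj h) (map f vs)"
    unfolding successively_map
  proof (rule successively_mono)
    show "successively (adj g) vs" using assms(4) by (simp add: is_cycle_def)
  qed (use sub f(3) in blast)
  moreover have "adj h (last (map f vs)) (hd (map f vs))"
  proof -
    have "last vs \<in> verts g" "hd vs \<in> verts g" using ne sub by auto
    then show ?thesis using assms(4) ne f(3) by (simp add: is_cycle_def last_map hd_map)
  qed
  ultimately have "is_cycle h (map f vs)" using assms(4) by (auto simp: is_cycle_def)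
  then show ?thesis ..
qed

lemma tree_nbhd_acyclic: "tree_graph g \<Longrightarrow> \<not> is_cycle (nbhd g x r) vs"
  using is_cycle_mono[of "nbhd g x r" vs g] unfolding tree_graph_def by (auto simp: nbhd_def adj_def)

section \<open>Averages of local functions\<close>

lemma random_graph_finite_simple:
  "random_graph M g \<Longrightarrow> \<omega> \<in> space M \<Longrightarrow> finite_simple_graph (g \<omega>)"
  unfolding random_graph_def by (auto dest: measurable_space)

lemma random_graph_measurable:
  assumes "random_graph M g" "\<And>a. finite_simple_graph a \<Longrightarrow> F a \<in> space L"
  shows "(\<lambda>\<omega>. F (g \<omega>)) \<in> M \<rightarrow>\<^sub>M L"
  using assms unfolding random_graph_def
  by (intro measurable_compose[of g M "count_space {a. finite_simple_graph a}" F L]) auto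

lemma (in prob_space) prob_levels_sums_1:
  assumes T[measurable]: "T \<in> M \<rightarrow>\<^sub>M count_space (UNIV :: nat set)"
  shows "(\<lambda>i. prob {x \<in> space M. T x = i}) sums 1"
proof -
  have "(\<lambda>i. prob {x \<in> space M. T x = i}) sums prob (\<Union>i. {x \<in> space M. T x = i})"
    by (rule finite_measure_UNION) (auto simp: disjoint_family_on_def)
  moreover have "(\<Union>i. {x \<in> space M. T x = i}) = space M" by auto
  ultimately show ?thesis using prob_space by simp
qed

lemma average_truncation:
  fixes f :: "nat \<Rightarrow> real" and T :: "'a \<Rightarrow> nat"
  assumes "finite V" "V \<noteq> {}" and f: "\<And>i. 0 \<le> f i" "\<And>i. f i \<le> K"
  shows "\<bar>(\<Sum>v\<in>V. f (T v)) / card V - (\<Sum>i<m. f i * (card {v \<in> V. T v = i} / card V))\<bar>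
    \<le> K * (1 - (\<Sum>i<m. card {v \<in> V. T v = i} / card V))"
proof -
  let ?P = "pmf_of_set V"
  have "measure_pmf.prob ?P {x. T x = i} = card {v \<in> V. T v = i} / card V" for i
  proof -
    have "V \<inter> {x. T x = i} = {v \<in> V. T v = i}" by auto
    then show ?thesis using measure_pmf_of_set[OF assms(2,1), of "{x. T x = i}"] by simp
  qed
  then show ?thesis
    using measure_pmf.integral_discrete_truncation[of T ?P f K m] f
      integral_pmf_of_set[OF assms(2,1), of "\<lambda>x. f (T x)"] by simp
qed

lemma iso_type_nbhd_event:
  assumes "\<And>x. x \<in> S \<Longrightarrow> simple_graph (g x) \<and> locally_finite_graph (g x) \<and> v x \<in> verts (g x)"
  shows "{x \<in> S. iso_type (nbhd (g x) (v x) r) (v x) = i} =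
    (if iso_type (fst (nat_rooted_graph i)) (snd (nat_rooted_graph i)) = i
     then {x \<in> S. rooted_iso (nbhd (g x) (v x) r) (v x) (fst (nat_rooted_graph i)) (snd (nat_rooted_graph i))}
     else {})"
proof -
  have "iso_type (nbhd (g x) (v x) r) (v x) = i \<longleftrightarrow>
    iso_type (fst (nat_rooted_graph i)) (snd (nat_rooted_graph i)) = i \<and>
    rooted_iso (nbhd (g x) (v x) r) (v x) (fst (nat_rooted_graph i)) (snd (nat_rooted_graph i))"
    if "x \<in> S" for x
    using assms[OF that] by (intro iso_type_eq_iff finite_simple_nbhd root_in_nbhd) auto
  then show ?thesis by auto
qed

lemma iso_type_measurable:
  fixes \<Gamma> :: "'u \<Rightarrow> 'a ugraph"
  assumes "random_rooted_graph N \<Gamma> ro"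
  shows "(\<lambda>x. iso_type (nbhd (\<Gamma> x) (ro x) r) (ro x)) \<in> N \<rightarrow>\<^sub>M count_space UNIV"
proof (subst measurable_count_space_eq2_countable, intro conjI ballI)
  fix i :: nat
  let ?H = "fst (nat_rooted_graph i)" and ?z = "snd (nat_rooted_graph i)"
  let ?S = "{x \<in> space N. rooted_iso (nbhd (\<Gamma> x) (ro x) r) (ro x) ?H ?z}"
  have S: "?S \<in> sets N"
    using assms nat_rooted_graph_in[of i] unfolding random_rooted_graph_def by blast
  have "(\<lambda>x. iso_type (nbhd (\<Gamma> x) (ro x) r) (ro x)) -` {i} \<inter> space N
      = {x \<in> space N. iso_type (nbhd (\<Gamma> x) (ro x) r) (ro x) = i}" by auto
  also have "\<dots> = (if iso_type ?H ?z = i then ?S else {})"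
    using assms unfolding random_rooted_graph_def by (intro iso_type_nbhd_event) auto
  finally have "(\<lambda>x. iso_type (nbhd (\<Gamma> x) (ro x) r) (ro x)) -` {i} \<inter> space N
      = (if iso_type ?H ?z = i then ?S else {})" .
  then show "(\<lambda>x. iso_type (nbhd (\<Gamma> x) (ro x) r) (ro x)) -` {i} \<inter> space N \<in> sets N"
    using S by simp
qed auto

text \<open>Local convergence in probability says that the empirical frequency of each isomorphism type of
  \<open>r\<close>-neighbourhoods converges. As the limit frequencies sum to 1, finitely many types carry almost all
  of the mass, and the averages of all bounded functions of the type converge.\<close>

lemma local_average_tendsto_in_prob:
  fixes G :: "nat \<Rightarrow> 'w \<Rightarrow> 'v ugraph" and \<Gamma> :: "'u \<Rightarrow> 'a ugraph" and f :: "nat \<Rightarrow> real"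
  assumes M: "prob_space M" and N: "prob_space N"
    and G: "\<And>n. n \<ge> 1 \<Longrightarrow> random_graph M (G n)"
    and card: "\<And>n \<omega>. n \<ge> 1 \<Longrightarrow> \<omega> \<in> space M \<Longrightarrow> card (verts (G n \<omega>)) = n"
    and \<Gamma>: "random_rooted_graph N \<Gamma> ro"
    and conv: "converges_locally_in_prob M G N \<Gamma> ro"
    and f: "\<And>i. 0 \<le> f i" "\<And>i. f i \<le> K"
  shows "tendsto_in_prob M
    (\<lambda>n \<omega>. (\<Sum>v\<in>verts (G n \<omega>). f (iso_type (nbhd (G n \<omega>) v r) v)) / real n)
    (\<lambda>_. \<integral>x. f (iso_type (nbhd (\<Gamma> x) (ro x) r) (ro x)) \<partial>N)"
proof -
  interpret N: prob_space N by fact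
  have K: "K \<ge> 0" using f[of 0] by linarith
  define T where "T x = iso_type (nbhd (\<Gamma> x) (ro x) r) (ro x)" for x
  have T: "T \<in> N \<rightarrow>\<^sub>M count_space UNIV" unfolding T_def by (rule iso_type_measurable[OF \<Gamma>])
  define p where "p i = measure N {x \<in> space N. T x = i}" for i
  \<comment> \<open>the empirical frequency of type \<open>i\<close>, with limit \<open>p i\<close>\<close>
  define P where "P i n \<omega> = card {v \<in> verts (G n \<omega>). iso_type (nbhd (G n \<omega>) v r) v = i} / real n" for i n \<omega>
  have P: "tendsto_in_prob M (P i) (\<lambda>_. p i)" for i
  proof -
    let ?H = "fst (nat_rooted_graph i)" and ?z = "snd (nat_rooted_graph i)"
    have "tendsto_in_prob M
          (\<lambda>n \<omega>. real (card {v \<in> verts (G n \<omega>). rooted_iso (nbhd (G n \<omega>) v r) v ?H ?z})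
                   / real (card (verts (G n \<omega>))))
          (\<lambda>_. measure N {x \<in> space N. rooted_iso (nbhd (\<Gamma> x) (ro x) r) (ro x) ?H ?z})"
      using conv nat_rooted_graph_in[of i] unfolding converges_locally_in_prob_def by blast
    note lim = this
    have pi: "p i = (if iso_type ?H ?z = i
      then measure N {x \<in> space N. rooted_iso (nbhd (\<Gamma> x) (ro x) r) (ro x) ?H ?z} else 0)"
    proof -
      have "{x \<in> space N. T x = i} = (if iso_type ?H ?z = i
        then {x \<in> space N. rooted_iso (nbhd (\<Gamma> x) (ro x) r) (ro x) ?H ?z} else {})"
        using \<Gamma> unfolding random_rooted_graph_def T_def by (intro iso_type_nbhd_event) auto
      then show ?thesis unfolding p_def by simp
    qed
    have Pi: "P i n \<omega> = (if iso_type ?H ?z = i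
      then real (card {v \<in> verts (G n \<omega>). rooted_iso (nbhd (G n \<omega>) v r) v ?H ?z})
        / real (card (verts (G n \<omega>))) else 0)" if n: "n \<ge> 1" and \<omega>: "\<omega> \<in> space M" for n \<omega>
    proof -
      have g: "finite_simple_graph (G n \<omega>)" using random_graph_finite_simple[OF G[OF n] \<omega>] .
      then have g': "simple_graph (G n \<omega>)" "locally_finite_graph (G n \<omega>)"
        using locally_finite_of_finite by (auto simp: finite_simple_graph_def)
      have "{v \<in> verts (G n \<omega>). iso_type (nbhd (G n \<omega>) v r) v = i} = (if iso_type ?H ?z = i
        then {v \<in> verts (G n \<omega>). rooted_iso (nbhd (G n \<omega>) v r) v ?H ?z} else {})"
        using g' by (intro iso_type_nbhd_event) auto
      then show ?thesis unfolding P_def card[OF n \<omega>] by simp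
    qed
    show ?thesis
    proof (cases "iso_type ?H ?z = i")
      case True
      then show ?thesis using tendsto_in_prob_cong[OF lim, of "P i"] Pi pi by simp
    next
      case False
      have "tendsto_in_prob M (\<lambda>_ _. 0) (\<lambda>_. 0)" by (simp add: tendsto_in_prob_def)
      then show ?thesis using tendsto_in_prob_cong[of M "\<lambda>_ _. 0" _ "P i"] Pi pi False by simp
    qed
  qed
  have Pm: "P i n \<in> borel_measurable M" if "n \<ge> 1" for i n
    unfolding P_def by (rule random_graph_measurable[OF G[OF that]]) simp
  have sums: "(\<lambda>m. \<Sum>i<m. p i) \<longlonglongrightarrow> 1"
    using N.prob_levels_sums_1[OF T] unfolding p_def sums_def .
  show ?thesis
  proof (rule tendsto_in_prob_squeeze[OF M])
    fix \<epsilon> :: real assume \<epsilon>: "\<epsilon> > 0"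
    have "\<forall>\<^sub>F m in sequentially. (\<Sum>i<m. p i) > 1 - \<epsilon> / (2 * K + 1)"
      using \<epsilon> K by (intro order_tendstoD(1)[OF sums]) (simp add: add_pos_nonneg)
    then obtain m where m: "(\<Sum>i<m. p i) > 1 - \<epsilon> / (2 * K + 1)"
      by (metis eventually_happens trivial_limit_sequentially)
    let ?R = "\<lambda>n \<omega>. \<Sum>i<m. \<bar>P i n \<omega> - p i\<bar>"
    have "\<bar>(\<Sum>v\<in>verts (G n \<omega>). f (iso_type (nbhd (G n \<omega>) v r) v)) / real n - (\<integral>x. f (T x) \<partial>N)\<bar>
      \<le> (2 * K) * ?R n \<omega> + \<epsilon>" if n: "n \<ge> 1" and \<omega>: "\<omega> \<in> space M" for n \<omega>
    proof -
      let ?X = "(\<Sum>v\<in>verts (G n \<omega>). f (iso_type (nbhd (G n \<omega>) v r) v)) / real n"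
      have V: "finite (verts (G n \<omega>))" "verts (G n \<omega>) \<noteq> {}"
        using random_graph_finite_simple[OF G[OF n] \<omega>] card[OF n \<omega>] n
        by (auto simp: finite_simple_graph_def)
      have 1: "\<bar>?X - (\<Sum>i<m. f i * P i n \<omega>)\<bar> \<le> K * (1 - (\<Sum>i<m. P i n \<omega>))"
        using average_truncation[where f = f and K = K and m = m and
          T = "\<lambda>v. iso_type (nbhd (G n \<omega>) v r) v", OF V f]
        unfolding card[OF n \<omega>] P_def .
      have 2: "\<bar>(\<integral>x. f (T x) \<partial>N) - (\<Sum>i<m. f i * p i)\<bar> \<le> K * (1 - (\<Sum>i<m. p i))"
        using N.integral_discrete_truncation[OF T f, where m = m] unfolding p_def .
      have 3: "\<bar>(\<Sum>i<m. f i * P i n \<omega>) - (\<Sum>i<m. f i * p i)\<bar> \<le> K * ?R n \<omega>"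
      proof -
        have "\<bar>\<Sum>i<m. f i * P i n \<omega> - f i * p i\<bar> \<le> (\<Sum>i<m. \<bar>f i * P i n \<omega> - f i * p i\<bar>)"
          by (rule sum_abs)
        also have "\<dots> = (\<Sum>i<m. f i * \<bar>P i n \<omega> - p i\<bar>)"
          using f(1) by (intro sum.cong) (auto simp: abs_mult simp flip: right_diff_distrib)
        also have "\<dots> \<le> (\<Sum>i<m. K * \<bar>P i n \<omega> - p i\<bar>)"
          using f(2) by (intro sum_mono mult_right_mono) auto
        finally show ?thesis by (simp add: sum_subtractf sum_distrib_left)
      qed
      have 4: "K * (1 - (\<Sum>i<m. P i n \<omega>)) \<le> K * (1 - (\<Sum>i<m. p i)) + K * ?R n \<omega>"
      proof -
        have "(\<Sum>i<m. p i) - (\<Sum>i<m. P i n \<omega>) = (\<Sum>i<m. p i - P i n \<omega>)" by (simp add: sum_subtractf)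
        also have "\<dots> \<le> ?R n \<omega>" by (intro sum_mono) auto
        finally have "1 - (\<Sum>i<m. P i n \<omega>) \<le> (1 - (\<Sum>i<m. p i)) + ?R n \<omega>" by simp
        from mult_left_mono[OF this K] show ?thesis by (simp add: distrib_left)
      qed
      have "K * (1 - (\<Sum>i<m. p i)) \<le> K * (\<epsilon> / (2 * K + 1))" using m K by (intro mult_left_mono) auto
      moreover have "2 * (K * (\<epsilon> / (2 * K + 1))) \<le> \<epsilon>"
        using K \<epsilon> by (simp add: field_simps add_pos_nonneg)
      ultimately show ?thesis using 1 2 3 4 by linarith
    qed
    moreover have "tendsto_in_prob M ?R (\<lambda>_. 0)"
      using P Pm by (intro tendsto_in_prob_sum_abs_diff[OF M]) auto
    moreover have "\<forall>n\<ge>1. ?R n \<in> borel_measurable M" using Pm by auto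
    ultimately show "\<exists>R C. C \<ge> 0 \<and> tendsto_in_prob M R (\<lambda>_. 0)
      \<and> (\<forall>n\<ge>1. R n \<in> borel_measurable M)
      \<and> (\<forall>n\<ge>1. \<forall>\<omega>\<in>space M. \<bar>(\<Sum>v\<in>verts (G n \<omega>). f (iso_type (nbhd (G n \<omega>) v r) v)) / real n -
          (\<integral>x. f (iso_type (nbhd (\<Gamma> x) (ro x) r) (ro x)) \<partial>N)\<bar> \<le> C * R n \<omega> + \<epsilon>)"
      using K unfolding T_def by (intro exI[of _ ?R] exI[of _ "2 * K"]) auto
  qed
qed

lemma cyclic_iso_type:
  assumes g: "simple_graph g" "locally_finite_graph g" "x \<in> verts g"
  shows "(\<exists>vs. is_cycle (fst (nat_rooted_graph (iso_type (nbhd g x r) x))) vs)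
    \<longleftrightarrow> (\<exists>vs. is_cycle (nbhd g x r) vs)"
proof -
  note iso = rooted_iso_iso_type[OF finite_simple_nbhd[OF g(1,2)] root_in_nbhd[OF g(3)], of r]
  have s: "simple_graph (fst (nat_rooted_graph i))" for i
    using nat_rooted_graph_in by (auto simp: finite_simple_graph_def)
  show ?thesis
    using rooted_iso_cycle[OF simple_nbhd[OF g(1)] root_in_nbhd[OF g(3)] iso]
      rooted_iso_cycle[OF s nat_rooted_graph_in(2) rooted_iso_sym[OF root_in_nbhd[OF g(3)] iso]]
    by blast
qed

lemma vdegree_iso_type:
  assumes g: "simple_graph g" "locally_finite_graph g" "x \<in> verts g"
  shows "vdegree (fst (nat_rooted_graph (iso_type (nbhd g x 1) x))) (snd (nat_rooted_graph (iso_type (nbhd g x 1) x)))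
    = vdegree g x"
proof -
  note iso = rooted_iso_iso_type[OF finite_simple_nbhd[OF g(1,2)] root_in_nbhd[OF g(3)], of 1]
  have s: "simple_graph (fst (nat_rooted_graph i))" for i
    using nat_rooted_graph_in by (auto simp: finite_simple_graph_def)
  show ?thesis
    using rooted_iso_vdegree[OF simple_nbhd[OF g(1)] s root_in_nbhd[OF g(3)] iso]
      vdegree_nbhd[OF g(1,3)] by simp
qed

lemma cyclic_fraction_tendsto_0:
  fixes G :: "nat \<Rightarrow> 'w \<Rightarrow> 'v ugraph" and \<Gamma> :: "'u \<Rightarrow> 'a ugraph"
  assumes M: "prob_space M" and N: "prob_space N"
    and G: "\<And>n. n \<ge> 1 \<Longrightarrow> random_graph M (G n)"
    and card: "\<And>n \<omega>. n \<ge> 1 \<Longrightarrow> \<omega> \<in> space M \<Longrightarrow> card (verts (G n \<omega>)) = n"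
    and ltl: "locally_tree_like M G N \<Gamma> ro"
  shows "tendsto_in_prob M (\<lambda>n \<omega>. card (cyclic_nbhd_verts (G n \<omega>) r) / real n) (\<lambda>_. 0)"
proof -
  have \<Gamma>: "random_rooted_graph N \<Gamma> ro" and tree: "AE x in N. tree_graph (\<Gamma> x)"
    and conv: "converges_locally_in_prob M G N \<Gamma> ro"
    using ltl unfolding locally_tree_like_def by auto
  define f where "f i = (if \<exists>vs. is_cycle (fst (nat_rooted_graph i)) vs then 1 else 0 :: real)" for i
  have "(\<integral>x. f (iso_type (nbhd (\<Gamma> x) (ro x) r) (ro x)) \<partial>N) = (\<integral>x. 0 \<partial>N)"
  proof (rule integral_cong_AE)
    show "AE x in N. f (iso_type (nbhd (\<Gamma> x) (ro x) r) (ro x)) = 0"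
      using tree AE_space
    proof eventually_elim
      case (elim x)
      then have "\<not> (\<exists>vs. is_cycle (fst (nat_rooted_graph (iso_type (nbhd (\<Gamma> x) (ro x) r) (ro x)))) vs)"
        using \<Gamma> tree_nbhd_acyclic[OF elim(1)] unfolding random_rooted_graph_def by (subst cyclic_iso_type) auto
      then show ?case by (simp add: f_def)
    qed
  qed (auto intro: measurable_compose[OF iso_type_measurable[OF \<Gamma>]])
  then have int: "(\<integral>x. f (iso_type (nbhd (\<Gamma> x) (ro x) r) (ro x)) \<partial>N) = 0" by simp
  have avg: "(\<Sum>v\<in>verts (G n \<omega>). f (iso_type (nbhd (G n \<omega>) v r) v)) / real n
      = card (cyclic_nbhd_verts (G n \<omega>) r) / real n" if "n \<ge> 1" "\<omega> \<in> space M" for n \<omega>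
  proof -
    have g: "finite_simple_graph (G n \<omega>)" using random_graph_finite_simple[OF G] that by blast
    then have g': "simple_graph (G n \<omega>)" "locally_finite_graph (G n \<omega>)" "finite (verts (G n \<omega>))"
      using locally_finite_of_finite by (auto simp: finite_simple_graph_def)
    have "(\<Sum>v\<in>verts (G n \<omega>). f (iso_type (nbhd (G n \<omega>) v r) v))
      = (\<Sum>v\<in>verts (G n \<omega>). if \<exists>vs. is_cycle (nbhd (G n \<omega>) v r) vs then 1 else 0)"
      unfolding f_def using g' by (intro sum.cong refl) (simp add: cyclic_iso_type)
    also have "\<dots> = card (cyclic_nbhd_verts (G n \<omega>) r)"
      unfolding cyclic_nbhd_verts_def using g'(3) by (simp flip: sum.inter_filter)
    finally show ?thesis by simp
  qed
  have "tendsto_in_prob M (\<lambda>n \<omega>. (\<Sum>v\<in>verts (G n \<omega>). f (iso_type (nbhd (G n \<omega>) v r) v)) / real n) (\<lambda>_. 0)"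
    unfolding int[symmetric]
    by (rule local_average_tendsto_in_prob[OF M N G card \<Gamma> conv, of f 1]) (auto simp: f_def)
  from this show ?thesis by (rule tendsto_in_prob_cong[OF _ avg])
qed

section \<open>The mean degree\<close>

lemma vdegree_le_card:
  assumes "finite_simple_graph g"
  shows "vdegree g v \<le> card (verts g)"
proof -
  have "simple_graph g" "finite (verts g)" using assms by (auto simp: finite_simple_graph_def)
  moreover have "{u. adj g v u} \<subseteq> verts g" using adj_in_verts[OF \<open>simple_graph g\<close>] by blast
  ultimately show ?thesis by (simp add: vdegree_eq_card_neighbours card_mono)
qed

lemma sum_vdegree:
  assumes g: "finite_simple_graph g"
  shows "(\<Sum>v\<in>verts g. real (vdegree g v)) = 2 * real (card (edges g))"
proof -
  have "(\<Sum>v\<in>verts g. real (vdegree g v)) = (\<Sum>e\<in>edges g. real (card e))"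
    using sum_degree_weighted[OF g, of "\<lambda>_. 1"] by simp
  also have "\<dots> = (\<Sum>e\<in>edges g. 2)"
    using g by (intro sum.cong) (auto simp: finite_simple_graph_def simple_graph_def)
  finally show ?thesis by simp
qed

lemma degree_kernel_measurable:
  assumes "random_graph M g"
  shows "(\<lambda>\<omega>. distr (measure_pmf (pmf_of_set (verts (g \<omega>)))) borel
                    (\<lambda>v. real (vdegree (g \<omega>) v))) \<in> M \<rightarrow>\<^sub>M subprob_algebra borel"
proof (rule random_graph_measurable[OF assms])
  fix a :: "'b ugraph"
  show "distr (measure_pmf (pmf_of_set (verts a))) borel (\<lambda>v. real (vdegree a v))
    \<in> space (subprob_algebra borel)"
    by (auto simp: space_subprob_algebra intro!: prob_space_imp_subprob_space
      prob_space.prob_space_distr measure_pmf.prob_space_axioms)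
qed

lemma real_distribution_degree_law:
  assumes "prob_space M" "random_graph M g"
  shows "real_distribution (degree_law M g)"
proof -
  interpret prob_space M by fact
  note k = degree_kernel_measurable[OF assms(2)]
  have "prob_space (degree_law M g)"
    unfolding degree_law_def
    by (rule prob_space_bind[OF _ k])
      (auto intro!: prob_space.prob_space_distr measure_pmf.prob_space_axioms)
  moreover have "sets (degree_law M g) = sets borel"
    unfolding degree_law_def by (rule sets_bind[OF sets_kernel[OF k] not_empty])
  ultimately show ?thesis by (simp add: real_distribution_def real_distribution_axioms_def)
qed

text \<open>Integration against a mixture of laws needs a bounded integrand. The degrees in a graph with \<open>n\<close>
  vertices are at most \<open>n\<close>, so \<open>f\<close> may be set to 0 outside of \<open>{0, \<dots>, n}\<close>.\<close>

lemma integral_degree_law: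
  fixes f :: "real \<Rightarrow> real"
  assumes M: "prob_space M" and g: "random_graph M g" and n: "n \<ge> 1"
    and card: "\<And>\<omega>. \<omega> \<in> space M \<Longrightarrow> card (verts (g \<omega>)) = n"
    and f[measurable]: "f \<in> borel_measurable borel"
  shows "(\<integral>x. f x \<partial>degree_law M g)
    = (\<integral>\<omega>. (\<Sum>v\<in>verts (g \<omega>). f (real (vdegree (g \<omega>) v))) / real n \<partial>M)"
proof -
  interpret prob_space M by fact
  interpret D: real_distribution "degree_law M g" by (rule real_distribution_degree_law[OF M g])
  let ?k = "\<lambda>\<omega>. distr (measure_pmf (pmf_of_set (verts (g \<omega>)))) borel (\<lambda>v. real (vdegree (g \<omega>) v))"
  note k = degree_kernel_measurable[OF g]
  let ?S = "real ` {..n}"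
  have S: "?S \<in> sets borel" by (intro borel_closed finite_imp_closed) simp
  define f' where "f' x = f x * indicator ?S x" for x
  have f'[measurable]: "f' \<in> borel_measurable borel" unfolding f'_def using S by measurable
  have V: "finite (verts (g \<omega>))" "verts (g \<omega>) \<noteq> {}" and deg: "real (vdegree (g \<omega>) v) \<in> ?S"
    if "\<omega> \<in> space M" for \<omega> v
  proof -
    have fs: "finite_simple_graph (g \<omega>)" by (rule random_graph_finite_simple[OF g that])
    show "finite (verts (g \<omega>))" "verts (g \<omega>) \<noteq> {}"
      using fs card[OF that] n by (auto simp: finite_simple_graph_def)
    show "real (vdegree (g \<omega>) v) \<in> ?S" using vdegree_le_card[OF fs, of v] card[OF that] by auto
  qed
  have "AE x in degree_law M g. x \<in> ?S"
    unfolding degree_law_def using S deg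
    by (subst AE_bind[OF k]) (auto intro!: AE_I2 simp: AE_distr_iff)
  then have "(\<integral>x. f x \<partial>degree_law M g) = (\<integral>x. f' x \<partial>degree_law M g)"
  proof (intro integral_cong_AE)
    assume "AE x in degree_law M g. x \<in> ?S"
    then show "AE x in degree_law M g. f x = f' x" by eventually_elim (simp add: f'_def)
  qed (use f f' in simp_all)
  also have "\<dots> = (\<integral>\<omega>. (\<integral>x. f' x \<partial>?k \<omega>) \<partial>M)"
    unfolding degree_law_def
  proof (rule integral_bind[OF f' _ k finite_measure_axioms])
    show "\<bar>f' x\<bar> \<le> (\<Sum>i\<le>n. \<bar>f (real i)\<bar>)" for x
    proof (cases "x \<in> ?S")
      case True
      then obtain i where "i \<le> n" "x = real i" by auto
      then show ?thesis using member_le_sum[of i "{..n}" "\<lambda>i. \<bar>f (real i)\<bar>"] by (simp add: f'_def)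
    qed (simp add: f'_def sum_nonneg)
    show "AE x in M. emeasure (?k x) (space (?k x)) \<le> ennreal 1"
    proof (rule AE_I2)
      fix x
      have "prob_space (?k x)" by (intro measure_pmf.prob_space_distr) simp
      then show "emeasure (?k x) (space (?k x)) \<le> ennreal 1"
        by (simp only: prob_space.emeasure_space_1 ennreal_1 order_refl)
    qed
  qed
  also have "\<dots> = (\<integral>\<omega>. (\<Sum>v\<in>verts (g \<omega>). f (real (vdegree (g \<omega>) v))) / real n \<partial>M)"
  proof (rule Bochner_Integration.integral_cong[OF refl])
    fix \<omega> assume \<omega>: "\<omega> \<in> space M"
    have "(\<integral>x. f' x \<partial>?k \<omega>) = (\<integral>v. f' (real (vdegree (g \<omega>) v)) \<partial>pmf_of_set (verts (g \<omega>)))"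
      by (subst integral_distr) auto
    also have "\<dots> = (\<integral>v. f (real (vdegree (g \<omega>) v)) \<partial>pmf_of_set (verts (g \<omega>)))"
      using deg[OF \<omega>] by (simp add: f'_def)
    also have "\<dots> = (\<Sum>v\<in>verts (g \<omega>). f (real (vdegree (g \<omega>) v))) / real n"
      using integral_pmf_of_set[OF V(2)[OF \<omega>] V(1)[OF \<omega>]] card[OF \<omega>] by simp
    finally show "(\<integral>x. f' x \<partial>?k \<omega>) = (\<Sum>v\<in>verts (g \<omega>). f (real (vdegree (g \<omega>) v))) / real n" .
  qed
  finally show ?thesis .
qed

text \<open>The graph of index 0 is arbitrary, so its degree law need not be a distribution; the sequence is
  shifted by one.\<close>

lemma weak_conv_degree_law:
  assumes M: "prob_space M" and G: "\<And>n. n \<ge> 1 \<Longrightarrow> random_graph M (G n)"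
    and \<mu>: "real_distribution \<mu>" and weak: "weak_conv_m (\<lambda>n. degree_law M (G n)) \<mu>"
    and f: "\<And>x. isCont f x" "\<And>x. \<bar>f x\<bar> \<le> (K::real)"
  shows "(\<lambda>n. \<integral>x. f x \<partial>degree_law M (G n)) \<longlonglongrightarrow> (\<integral>x. f x \<partial>\<mu>)"
proof -
  have w: "weak_conv_m (\<lambda>n. degree_law M (G (Suc n))) \<mu>"
    unfolding weak_conv_m_def weak_conv_def
  proof (intro allI impI)
    fix x assume "isCont (cdf \<mu>) x"
    then have "(\<lambda>n. cdf (degree_law M (G n)) x) \<longlonglongrightarrow> cdf \<mu> x"
      using weak unfolding weak_conv_m_def weak_conv_def by simp
    then show "(\<lambda>n. cdf (degree_law M (G (Suc n))) x) \<longlonglongrightarrow> cdf \<mu> x" by (rule LIMSEQ_Suc)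
  qed
  have "(\<lambda>n. \<integral>x. f x \<partial>degree_law M (G (Suc n))) \<longlonglongrightarrow> (\<integral>x. f x \<partial>\<mu>)"
    using f by (intro weak_conv_imp_integral_bdd_continuous_conv[OF _ \<mu> w])
      (auto intro!: real_distribution_degree_law[OF M G])
  then show ?thesis by (rule LIMSEQ_imp_Suc)
qed

text \<open>The degree is an unbounded function of the 1-neighbourhood, so local convergence alone does not
  give convergence of its average \<open>X n\<close>; mass could escape to infinity. The averages \<open>Y K n\<close> of the
  degrees truncated at \<open>K\<close> do converge in probability, to \<open>c K\<close>. By weak convergence of the degree laws,
  \<open>c K\<close> is also a truncated mean of the limit law \<open>\<mu>\<close>, and it tends to the mean of \<open>\<mu>\<close>, which is
  therefore the mean root degree. As the expectation of \<open>X n\<close> has the same limit, the nonnegative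
  difference \<open>X n - Y K n\<close> has small expectation and is controlled by Markov's inequality.\<close>

lemma mean_degree_tendsto_in_prob:
  fixes G :: "nat \<Rightarrow> 'w \<Rightarrow> 'v ugraph" and \<Gamma> :: "'u \<Rightarrow> 'a ugraph"
  assumes M: "prob_space M" and N: "prob_space N"
    and G: "\<And>n. n \<ge> 1 \<Longrightarrow> random_graph M (G n)"
    and card: "\<And>n \<omega>. n \<ge> 1 \<Longrightarrow> \<omega> \<in> space M \<Longrightarrow> card (verts (G n \<omega>)) = n"
    and ltl: "locally_tree_like M G N \<Gamma> ro"
  shows "tendsto_in_prob M (\<lambda>n \<omega>. 2 * real (card (edges (G n \<omega>))) / real n)
    (\<lambda>_. \<integral>x. real (vdegree (\<Gamma> x) (ro x)) \<partial>N)"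
proof -
  interpret M: prob_space M by fact
  interpret N: prob_space N by fact
  have \<Gamma>: "random_rooted_graph N \<Gamma> ro" and conv: "converges_locally_in_prob M G N \<Gamma> ro"
    and us: "uniformly_sparse M G"
    using ltl unfolding locally_tree_like_def by auto
  obtain \<mu> where \<mu>: "real_distribution \<mu>" and weak: "weak_conv_m (\<lambda>n. degree_law M (G n)) \<mu>"
    and int\<mu>: "integrable \<mu> (\<lambda>x. x)"
    and mean: "(\<lambda>n. \<integral>x. x \<partial>degree_law M (G n)) \<longlonglongrightarrow> (\<integral>x. x \<partial>\<mu>)"
    using us unfolding uniformly_sparse_def by blast
  interpret \<mu>: real_distribution \<mu> by fact
  define D where "D x = real (vdegree (\<Gamma> x) (ro x))" for x
  define X where "X n \<omega> = 2 * real (card (edges (G n \<omega>))) / real n" for n \<omega>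
  define Y where "Y K n \<omega> = (\<Sum>v\<in>verts (G n \<omega>). min (real (vdegree (G n \<omega>) v)) (real K)) / real n"
    for K n \<omega>
  define c where "c K = (\<integral>x. min (D x) (real K) \<partial>N)" for K :: nat
  let ?m = "\<integral>x. x \<partial>\<mu>"
  let ?deg = "\<lambda>i. real (vdegree (fst (nat_rooted_graph i)) (snd (nat_rooted_graph i)))"
  have D_eq: "?deg (iso_type (nbhd (\<Gamma> x) (ro x) 1) (ro x)) = D x" if "x \<in> space N" for x
    using \<Gamma> that unfolding random_rooted_graph_def D_def by (subst vdegree_iso_type) auto
  have Dm[measurable]: "D \<in> borel_measurable N"
  proof -
    have "(\<lambda>x. ?deg (iso_type (nbhd (\<Gamma> x) (ro x) 1) (ro x))) \<in> borel_measurable N"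
      by (rule measurable_compose[OF iso_type_measurable[OF \<Gamma>]]) simp
    then show ?thesis using D_eq by (subst (asm) measurable_cong) auto
  qed
  have fs: "finite_simple_graph (G n \<omega>)" if "n \<ge> 1" "\<omega> \<in> space M" for n \<omega>
    using random_graph_finite_simple[OF G] that by blast
  have X_eq: "X n \<omega> = (\<Sum>v\<in>verts (G n \<omega>). real (vdegree (G n \<omega>) v)) / real n"
    if "n \<ge> 1" "\<omega> \<in> space M" for n \<omega>
    unfolding X_def sum_vdegree[OF fs[OF that]] ..
  have Ym: "Y K n \<in> borel_measurable M" and Xm: "X n \<in> borel_measurable M" if "n \<ge> 1" for K n
    unfolding Y_def X_def by (rule random_graph_measurable[OF G[OF that]], simp)+
  have avg_le: "(\<Sum>v\<in>verts (G n \<omega>). min (real (vdegree (G n \<omega>) v)) (real K)) / real n \<le> real K"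
    if "n \<ge> 1" "\<omega> \<in> space M" for K n \<omega>
  proof -
    have "(\<Sum>v\<in>verts (G n \<omega>). min (real (vdegree (G n \<omega>) v)) (real K)) \<le> real n * real K"
      using sum_bounded_above[of "verts (G n \<omega>)" "\<lambda>v. min (real (vdegree (G n \<omega>) v)) (real K)" "real K"]
        card[OF that] by simp
    then show ?thesis using that(1) by (simp add: field_simps)
  qed
  have Y_bd: "0 \<le> Y K n \<omega>" "Y K n \<omega> \<le> real K" "Y K n \<omega> \<le> X n \<omega>" "X n \<omega> \<le> real n"
    if "n \<ge> 1" "\<omega> \<in> space M" for K n \<omega>
  proof -
    show "0 \<le> Y K n \<omega>" unfolding Y_def by (intro divide_nonneg_nonneg sum_nonneg) auto
    show "Y K n \<omega> \<le> real K" unfolding Y_def by (rule avg_le[OF that])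
    show "Y K n \<omega> \<le> X n \<omega>" unfolding X_eq[OF that] Y_def by (intro divide_right_mono sum_mono) auto
    have "X n \<omega> = Y n n \<omega>"
      unfolding X_eq[OF that] Y_def using vdegree_le_card[OF fs[OF that]] card[OF that]
      by (simp add: min_absorb1)
    also have "\<dots> \<le> real n" unfolding Y_def by (rule avg_le[OF that])
    finally show "X n \<omega> \<le> real n" .
  qed
  have Y_lim: "tendsto_in_prob M (Y K) (\<lambda>_. c K)" for K
  proof -
    have c: "c K = (\<integral>x. min (?deg (iso_type (nbhd (\<Gamma> x) (ro x) 1) (ro x))) (real K) \<partial>N)"
      unfolding c_def using D_eq by (intro Bochner_Integration.integral_cong) auto
    have "tendsto_in_prob M (\<lambda>n \<omega>. (\<Sum>v\<in>verts (G n \<omega>).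
        min (?deg (iso_type (nbhd (G n \<omega>) v 1) v)) (real K)) / real n) (\<lambda>_. c K)"
      unfolding c by (rule local_average_tendsto_in_prob[OF M N G card \<Gamma> conv,
        of "\<lambda>i. min (?deg i) (real K)" "real K" 1]) auto
    then show ?thesis
    proof (rule tendsto_in_prob_cong)
      fix n :: nat and \<omega> assume n: "n \<ge> 1" "\<omega> \<in> space M"
      show "(\<Sum>v\<in>verts (G n \<omega>). min (?deg (iso_type (nbhd (G n \<omega>) v 1) v)) (real K)) / real n = Y K n \<omega>"
        unfolding Y_def using fs[OF n] locally_finite_of_finite[OF fs[OF n]]
        by (intro arg_cong2[where f = "(/)"] sum.cong refl)
          (subst vdegree_iso_type, auto simp: finite_simple_graph_def)
    qed
  qed
  have EY: "(\<lambda>n. \<integral>\<omega>. Y K n \<omega> \<partial>M) \<longlonglongrightarrow> c K" for K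
    by (rule integral_tendsto_of_tendsto_in_prob[OF M Y_lim Ym, of _ "real K"])
      (use Y_bd in \<open>auto simp: abs_of_nonneg\<close>)
  \<comment> \<open>a bounded continuous function that agrees with \<open>min x K\<close> on degrees\<close>
  let ?\<phi> = "\<lambda>K x. max (- real K) (min x (real K))"
  have c_eq: "c K = (\<integral>x. ?\<phi> K x \<partial>\<mu>)" for K
  proof (rule LIMSEQ_unique)
    show "(\<lambda>n. \<integral>x. ?\<phi> K x \<partial>degree_law M (G n)) \<longlonglongrightarrow> (\<integral>x. ?\<phi> K x \<partial>\<mu>)"
      by (rule weak_conv_degree_law[OF M G \<mu> weak, of _ "real K"]) (auto intro!: continuous_intros)
    have "\<forall>\<^sub>F n in sequentially. (\<integral>\<omega>. Y K n \<omega> \<partial>M) = (\<integral>x. ?\<phi> K x \<partial>degree_law M (G n))"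
    proof (rule eventually_sequentiallyI[of 1])
      fix n :: nat assume n: "1 \<le> n"
      have "?\<phi> K (real i) = min (real i) (real K)" for i by auto
      then show "(\<integral>\<omega>. Y K n \<omega> \<partial>M) = (\<integral>x. ?\<phi> K x \<partial>degree_law M (G n))"
        unfolding Y_def by (subst integral_degree_law[OF M G[OF n] n card[OF n]]) auto
    qed
    with EY show "(\<lambda>n. \<integral>x. ?\<phi> K x \<partial>degree_law M (G n)) \<longlonglongrightarrow> c K"
      by (rule Lim_transform_eventually)
  qed
  have c_lim: "c \<longlonglongrightarrow> ?m"
    unfolding c_eq
  proof (rule integral_dominated_convergence[where w = "\<lambda>x. \<bar>x\<bar>"])
    show "AE x in \<mu>. (\<lambda>K. ?\<phi> K x) \<longlonglongrightarrow> x"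
    proof (rule AE_I2)
      fix x :: real
      obtain K0 :: nat where K0: "\<bar>x\<bar> \<le> real K0" using real_arch_simple by blast
      have "\<forall>\<^sub>F K in sequentially. x = ?\<phi> K x"
      proof (rule eventually_sequentiallyI[of K0])
        fix K assume "K0 \<le> K"
        then have "\<bar>x\<bar> \<le> real K" using K0 by linarith
        then show "x = ?\<phi> K x" by auto
      qed
      then show "(\<lambda>K. ?\<phi> K x) \<longlonglongrightarrow> x" by (rule Lim_transform_eventually[OF tendsto_const])
    qed
    show "AE x in \<mu>. norm (?\<phi> K x) \<le> \<bar>x\<bar>" for K by (intro AE_I2) auto
    show "integrable \<mu> (\<lambda>x. \<bar>x\<bar>)" using int\<mu> by (rule integrable_abs)
  qed measurable
  have D_int: "(\<integral>x. D x \<partial>N) = ?m"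
  proof (rule integral_monotone_convergence[where f = "\<lambda>K x. min (D x) (real K)"])
    show "integrable N (\<lambda>x. min (D x) (real K))" for K
    proof (rule N.integrable_const_bound[of _ "real K"])
      show "AE x in N. norm (min (D x) (real K)) \<le> real K" by (intro AE_I2) (auto simp: D_def)
    qed measurable
    show "AE x in N. mono (\<lambda>K. min (D x) (real K))" by (intro AE_I2) (auto simp: mono_def)
    show "AE x in N. (\<lambda>K. min (D x) (real K)) \<longlonglongrightarrow> D x"
    proof (rule AE_I2)
      fix x
      have "\<forall>\<^sub>F K in sequentially. D x = min (D x) (real K)"
        by (rule eventually_sequentiallyI[of "vdegree (\<Gamma> x) (ro x)"]) (auto simp: D_def)
      then show "(\<lambda>K. min (D x) (real K)) \<longlonglongrightarrow> D x"
        by (rule Lim_transform_eventually[OF tendsto_const])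
    qed
    show "(\<lambda>K. \<integral>x. min (D x) (real K) \<partial>N) \<longlonglongrightarrow> ?m" using c_lim unfolding c_def .
  qed auto
  have EX: "(\<lambda>n. \<integral>\<omega>. X n \<omega> \<partial>M) \<longlonglongrightarrow> ?m"
  proof (rule Lim_transform_eventually[OF mean], rule eventually_sequentiallyI[of 1])
    fix n :: nat assume n: "1 \<le> n"
    have "(\<integral>x. x \<partial>degree_law M (G n))
      = (\<integral>\<omega>. (\<Sum>v\<in>verts (G n \<omega>). real (vdegree (G n \<omega>) v)) / real n \<partial>M)"
      by (rule integral_degree_law[OF M G[OF n] n card[OF n]]) auto
    also have "\<dots> = (\<integral>\<omega>. X n \<omega> \<partial>M)"
      using X_eq[OF n] by (intro Bochner_Integration.integral_cong) auto
    finally show "(\<integral>x. x \<partial>degree_law M (G n)) = (\<integral>\<omega>. X n \<omega> \<partial>M)" .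
  qed
  have "tendsto_in_prob M X (\<lambda>_. ?m)"
    unfolding tendsto_in_prob_def
  proof (intro allI impI tendstoI)
    fix \<epsilon> \<delta> :: real assume \<epsilon>: "\<epsilon> > 0" and \<delta>: "\<delta> > 0"
    define \<eta> where "\<eta> = min (\<epsilon> / 3) (\<delta> * \<epsilon> / 12)"
    have \<eta>: "\<eta> > 0" "\<eta> \<le> \<epsilon> / 3" "\<eta> \<le> \<delta> * \<epsilon> / 12" using \<epsilon> \<delta> by (auto simp: \<eta>_def)
    have "\<forall>\<^sub>F K in sequentially. dist (c K) ?m < \<eta>" using c_lim \<eta>(1) by (rule tendstoD)
    then obtain K where "dist (c K) ?m < \<eta>" using eventually_happens'[OF sequentially_bot] by blast
    then have K: "\<bar>c K - ?m\<bar> < \<eta>" by (simp add: dist_real_def)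
    have "(\<lambda>n. measure M {\<omega> \<in> space M. \<bar>Y K n \<omega> - c K\<bar> > \<epsilon> / 3}) \<longlonglongrightarrow> 0"
      by (rule Y_lim[unfolded tendsto_in_prob_def, rule_format]) (use \<epsilon> in simp)
    then have 1: "\<forall>\<^sub>F n in sequentially. measure M {\<omega> \<in> space M. \<bar>Y K n \<omega> - c K\<bar> > \<epsilon> / 3} < \<delta> / 2"
      using \<delta> by (intro order_tendstoD(2)) auto
    have "(\<lambda>n. (\<integral>\<omega>. X n \<omega> \<partial>M) - (\<integral>\<omega>. Y K n \<omega> \<partial>M)) \<longlonglongrightarrow> ?m - c K"
      by (intro tendsto_diff EX EY)
    then have 2: "\<forall>\<^sub>F n in sequentially. (\<integral>\<omega>. X n \<omega> \<partial>M) - (\<integral>\<omega>. Y K n \<omega> \<partial>M) < 2 * \<eta>"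
      using K \<eta>(1) by (intro order_tendstoD(2)) auto
    show "\<forall>\<^sub>F n in sequentially. dist (measure M {\<omega> \<in> space M. \<bar>X n \<omega> - ?m\<bar> > \<epsilon>}) 0 < \<delta>"
      using 1 2 eventually_ge_at_top[of 1]
    proof eventually_elim
      case (elim n)
      note n = elim(3)
      note [measurable] = Xm[OF n] Ym[OF n, of K]
      have X_nonneg: "0 \<le> X n \<omega>" if "\<omega> \<in> space M" for \<omega>
        using Y_bd(1)[OF n that, of K] Y_bd(3)[OF n that, of K] by linarith
      have iX: "integrable M (X n)"
        using Y_bd(4)[OF n] X_nonneg by (intro M.integrable_const_bound[of _ "real n"] AE_I2) auto
      have iY: "integrable M (Y K n)"
        using Y_bd(1,2)[OF n] by (intro M.integrable_const_bound[of _ "real K"] AE_I2) auto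
      let ?A = "{\<omega> \<in> space M. \<bar>Y K n \<omega> - c K\<bar> > \<epsilon> / 3}"
      let ?B = "{\<omega> \<in> space M. X n \<omega> - Y K n \<omega> \<ge> \<epsilon> / 3}"
      have "measure M {\<omega> \<in> space M. \<bar>X n \<omega> - ?m\<bar> > \<epsilon>} \<le> measure M (?A \<union> ?B)"
      proof (rule M.finite_measure_mono)
        show "{\<omega> \<in> space M. \<bar>X n \<omega> - ?m\<bar> > \<epsilon>} \<subseteq> ?A \<union> ?B"
        proof (clarify, rule ccontr)
          fix \<omega> assume \<omega>: "\<omega> \<in> space M" "\<epsilon> < \<bar>X n \<omega> - ?m\<bar>" "\<not> \<epsilon> / 3 \<le> X n \<omega> - Y K n \<omega>"
            "\<not> \<epsilon> / 3 < \<bar>Y K n \<omega> - c K\<bar>"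
          then show False using Y_bd(3)[OF n \<omega>(1), of K] K \<eta>(2) by linarith
        qed
      qed measurable
      also have "\<dots> \<le> measure M ?A + measure M ?B" by (rule measure_Un_le) measurable
      also have "measure M ?B \<le> (\<integral>\<omega>. X n \<omega> - Y K n \<omega> \<partial>M) / (\<epsilon> / 3)"
        using \<epsilon> Y_bd(3)[OF n] iX iY
        by (intro integral_Markov_inequality_measure[where A = "{}"]) auto
      also have "(\<integral>\<omega>. X n \<omega> - Y K n \<omega> \<partial>M) / (\<epsilon> / 3) < \<delta> / 2"
      proof -
        have "(\<integral>\<omega>. X n \<omega> - Y K n \<omega> \<partial>M) < \<delta> * \<epsilon> / 6" using iX iY elim(2) \<eta>(3) by simp
        then show ?thesis using \<epsilon> by (simp add: field_simps)
      qed
      finally show ?case using elim(1) by (simp add: dist_real_def)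
    qed
  qed
  then show ?thesis unfolding X_def D_int[symmetric] D_def .
qed

section \<open>The free energy of the random cluster model\<close>

theorem corollary1p8:
  fixes M :: "'w measure" and G :: "nat \<Rightarrow> 'w \<Rightarrow> 'v ugraph"
    and N :: "'u measure" and \<Gamma> :: "'u \<Rightarrow> 'a ugraph" and ro :: "'u \<Rightarrow> 'a"
    and q w B k \<beta> h :: real and L :: "'w \<Rightarrow> real"
  assumes "prob_space M" and "prob_space N"
    and "\<And>n. n \<ge> 1 \<Longrightarrow> random_graph M (G n)"
    and "\<And>n \<omega>. n \<ge> 1 \<Longrightarrow> \<omega> \<in> space M \<Longrightarrow> card (verts (G n \<omega>)) = n"
    and "locally_tree_like M G N \<Gamma> ro"
    and "q \<ge> 2" and "w \<ge> 0" and "B \<ge> 0"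
    and "k = 1 / 4 * ln ((1 + w) / (1 + w / (q - 1)))"
    and "\<beta> = 1 / 4 * ln ((1 + w) * (1 + w / (q - 1)))"
    and "h = 1 / 2 * ln (exp B / (q - 1))"
    and "L \<in> borel_measurable M"
    and "tendsto_in_prob M (\<lambda>n \<omega>. 1 / real n * ln (Z_eIsing (G n \<omega>) \<beta> k h)) L"
  shows "tendsto_in_prob M (\<lambda>n \<omega>. 1 / real n * ln (Z_rc (G n \<omega>) q w B))
           (\<lambda>\<omega>. \<beta> / 2 * (\<integral>x. real (vdegree (\<Gamma> x) (ro x)) \<partial>N)
                  + 1 / 2 * ln (exp (- B) * (q - 1)) + L \<omega>)"
proof (rule tendsto_in_prob_squeeze[OF \<open>prob_space M\<close>])
  note M = \<open>prob_space M\<close> and N = \<open>prob_space N\<close> and q = \<open>q \<ge> 2\<close>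
  note G = assms(3) and card = assms(4) and ltl = assms(5)
  define c where "c = (\<integral>x. real (vdegree (\<Gamma> x) (ro x)) \<partial>N)"
  define l where "l = 1 / 2 * ln (exp (- B) * (q - 1))"
  fix \<epsilon> :: real assume \<epsilon>: "\<epsilon> > 0"
  \<comment> \<open>a radius for which the clusters of size at least \<open>r\<close> contribute at most \<open>\<epsilon>\<close> per vertex\<close>
  obtain r0 :: nat where r0: "ln q / \<epsilon> \<le> real r0" using real_arch_simple by blast
  define r where "r = Suc r0"
  have r: "r \<ge> 1" and r\<epsilon>: "ln q / real r \<le> \<epsilon>"
    using r0 \<epsilon> by (auto simp: r_def field_simps)
  \<comment> \<open>the three random sequences whose deviations bound the total error\<close>
  define A where "A i n \<omega> =
     (if i = (0::nat) then 2 * real (card (edges (G n \<omega>))) / real n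
      else if i = 1 then 1 / real n * ln (Z_eIsing (G n \<omega>) \<beta> k h)
      else card (cyclic_nbhd_verts (G n \<omega>) r) / real n)" for i n \<omega>
  define a where "a i \<omega> = (if i = (0::nat) then c else if i = 1 then L \<omega> else 0)" for i \<omega>
  let ?R = "\<lambda>n \<omega>. \<Sum>i\<in>{0, 1, 2}. \<bar>A i n \<omega> - a i \<omega>\<bar>"
  have A_lim: "tendsto_in_prob M (A i) (a i)" for i
    using mean_degree_tendsto_in_prob[OF M N G card ltl] assms(13)
      cyclic_fraction_tendsto_0[OF M N G card ltl, of r]
    unfolding A_def a_def c_def by (cases "i = 0"; cases "i = 1") simp_all
  have A_meas: "A i n \<in> borel_measurable M" if "n \<ge> 1" for i n
    unfolding A_def by (rule random_graph_measurable[OF G[OF that]]) simp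
  have a_meas: "a i \<in> borel_measurable M" for i
    unfolding a_def using assms(12) by (cases "i = 0"; cases "i = 1") simp_all
  let ?K = "\<bar>\<beta>\<bar> / 2 + 1 + ln q"
  have lnq: "ln q \<ge> 0" using q by simp
  have K: "?K \<ge> 0" using lnq by simp
  have le: "\<bar>1 / real n * ln (Z_rc (G n \<omega>) q w B) - (\<beta> / 2 * c + l + L \<omega>)\<bar> \<le> ?K * ?R n \<omega> + \<epsilon>"
    if n: "n \<ge> 1" and \<omega>: "\<omega> \<in> space M" for n \<omega>
  proof -
    let ?Z = "ln (Z_rc (G n \<omega>) q w B)" and ?I = "ln (Z_eIsing (G n \<omega>) \<beta> k h)"
    let ?E = "real (card (edges (G n \<omega>)))" and ?b = "real (card (cyclic_nbhd_verts (G n \<omega>) r))"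
    have n0: "real n > 0" using n by simp
    have "\<bar>?Z - (\<beta> * ?E + real n * l + ?I)\<bar> \<le> ln q * (real n / real r + ?b)"
      using ln_Z_rc_approx[OF random_graph_finite_simple[OF G[OF n] \<omega>] q assms(7,8) r assms(9-11)]
      unfolding card[OF n \<omega>] l_def .
    then have "\<bar>?Z - (\<beta> * ?E + real n * l + ?I)\<bar> / real n \<le> ln q * (real n / real r + ?b) / real n"
      using n0 by (intro divide_right_mono) auto
    also have "ln q * (real n / real r + ?b) / real n = ln q / real r + ln q * A 2 n \<omega>"
      using n0 r by (simp add: A_def field_simps)
    also have "\<bar>?Z - (\<beta> * ?E + real n * l + ?I)\<bar> / real n
      = \<bar>(?Z - (\<beta> * ?E + real n * l + ?I)) / real n\<bar>" using n0 by simp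
    also have "(?Z - (\<beta> * ?E + real n * l + ?I)) / real n
      = 1 / real n * ?Z - (\<beta> / 2 * A 0 n \<omega> + l + A 1 n \<omega>)"
      using n0 by (simp add: A_def field_simps)
    finally have 1: "\<bar>1 / real n * ?Z - (\<beta> / 2 * A 0 n \<omega> + l + A 1 n \<omega>)\<bar> \<le> \<epsilon> + ln q * A 2 n \<omega>"
      using r\<epsilon> by linarith
    let ?d = "\<lambda>i. \<bar>A i n \<omega> - a i \<omega>\<bar>"
    have R: "?R n \<omega> = ?d 0 + ?d 1 + ?d 2" by simp
    have 2: "\<bar>\<beta> / 2 * A 0 n \<omega> - \<beta> / 2 * c\<bar> \<le> \<bar>\<beta>\<bar> / 2 * ?R n \<omega>"
    proof -
      have "\<bar>\<beta> / 2 * A 0 n \<omega> - \<beta> / 2 * c\<bar> = \<bar>\<beta>\<bar> / 2 * ?d 0"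
        unfolding right_diff_distrib[symmetric] by (simp add: a_def abs_mult)
      also have "\<dots> \<le> \<bar>\<beta>\<bar> / 2 * ?R n \<omega>" unfolding R by (intro mult_left_mono) auto
      finally show ?thesis .
    qed
    have 3: "\<bar>A 1 n \<omega> - L \<omega>\<bar> \<le> ?R n \<omega>" unfolding R by (simp add: a_def)
    have 4: "ln q * A 2 n \<omega> \<le> ln q * ?R n \<omega>"
      unfolding R using lnq by (intro mult_left_mono) (auto simp: a_def)
    have "?K * ?R n \<omega> = \<bar>\<beta>\<bar> / 2 * ?R n \<omega> + ?R n \<omega> + ln q * ?R n \<omega>"
      by (simp only: distrib_right mult_1)
    then show ?thesis using 1 2 3 4 by linarith
  qed
  have "tendsto_in_prob M ?R (\<lambda>_. 0)"
    using A_lim A_meas a_meas by (intro tendsto_in_prob_sum_abs_diff[OF M]) auto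
  moreover have "\<forall>n\<ge>1. ?R n \<in> borel_measurable M" 
    by (intro allI impI borel_measurable_sum borel_measurable_abs borel_measurable_diff A_meas a_meas)
  ultimately show "\<exists>R K. K \<ge> 0 \<and> tendsto_in_prob M R (\<lambda>_. 0)
      \<and> (\<forall>n\<ge>1. R n \<in> borel_measurable M)
      \<and> (\<forall>n\<ge>1. \<forall>\<omega>\<in>space M. \<bar>1 / real n * ln (Z_rc (G n \<omega>) q w B)
        - (\<beta> / 2 * (\<integral>x. real (vdegree (\<Gamma> x) (ro x)) \<partial>N)
            + 1 / 2 * ln (exp (- B) * (q - 1)) + L \<omega>)\<bar> \<le> K * R n \<omega> + \<epsilon>)"
    using K le unfolding c_def l_def by (intro exI[of _ ?R] exI[of _ ?K]) blast
qed

end
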